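(* Let $H$ be an $n$-qubit Hamiltonian with unknown spectral decomposition $H=\sum_{j=0}^{N-1} E_j |E_j\rangle\langle E_j|$, where $N=2^n$, the $|E_j\rangle$ are orthonormal, and the eigenvalues satisfy $0\le E_0<E_1\le E_2\le\dots\le E_{N-1}\le\pi$, and let $\Delta_{\rm true}:=E_1-E_0$ be the spectral gap of $H$. Additionally, suppose we can prepare an $n$-qubit state $|\psi\rangle=\sum_{j=0}^{N-1}\gamma_j|E_j\rangle$ whose overlap with the ground state $|E_0\rangle$ satisfies $|\gamma_0|^2\ge\eta$, where $\eta\in(0,1)$ is known. Then for every $\beta\in[0,1]$ there exists an algorithm that, for any given $\epsilon>0$ and $\delta\in(0,1)$, estimates $E_0$ within additive error $\epsilon$ with probability at least $1-\delta$ by making use of $$\tilde{\mathcal O}\left(\eta^{-1}\left(\epsilon^{-2+2\beta}\Delta_{\rm true}^{2-2\beta}+\log\left(\epsilon^{-\beta}\Delta_{\rm true}^{\beta-1}\right)\right)\log(\delta^{-1})\right)$$ quantum circuits. Each circuit involves multiple applications of controlled-$e^{iHt_j}$ for various $t_j\in\mathbb{R}$ such that $$\sum_j|t_j|=\tilde{\mathcal O}\left(\epsilon^{-\beta}\Delta_{\rm true}^{-1+\beta}\log\left(\eta^{-1}\Delta_{\rm true}^{1-\beta}\epsilon^{\beta-1}\right)\right),$$ and uses $$\tilde{\mathcal O}\left(\epsilon^{-\beta}\Delta_{\rm true}^{-1+\beta}\log\left(\eta^{-1}\Delta_{\rm true}^{1-\beta}\epsilon^{\beta-1}\right)\right)$$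 additional elementary quantum gates.
   Context: Computational model: controlled-$e^{iHt}:=|0\rangle\langle 0|\otimes I+|1\rangle\langle 1|\otimes e^{iHt}$ can be implemented for any $t\in\mathbb{R}$. The algorithm accesses $H$ only through these operations and $|\psi\rangle$ only through preparing copies of it; it knows $\eta,\epsilon,\delta,\beta$ but not the spectral decomposition of $H$ nor the $\gamma_j$. The statement is one of existence of algorithms: the algorithm may use a parameter $\Delta=\Theta(\epsilon^{\beta}\Delta_{\rm true}^{1-\beta})$. Each quantum circuit it runs acts on an initial state $|0^k\rangle|\psi\rangle$ for some $k\ge1$, is composed of controlled-$e^{iHt_j}$ operations and elementary quantum gates (and measurements), and its outcomes are classically post-processed. $\tilde{\mathcal O}(f)$ means $\mathcal O(f\cdot\mathrm{polylog}(f))$ with absolute constants, and logarithmic factors inside asymptotic bounds are read as being at least $1$. *)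

theory Defs
  imports
    "HOL-Probability.Probability_Mass_Function"
    "Jordan_Normal_Form.Schur_Decomposition"
begin

unbundle no vec_syntax
hide_const (open) Finite_Cartesian_Product.vec Finite_Cartesian_Product.mat
hide_type (open) Finite_Cartesian_Product.vec

definition kron :: "complex mat \<Rightarrow> complex mat \<Rightarrow> complex mat" where
  "kron A B = mat (dim_row A * dim_row B) (dim_col A * dim_col B)
     (\<lambda>(i, j). A $$ (i div dim_row B, j div dim_col B) * B $$ (i mod dim_row B, j mod dim_col B))"

definition kron_vec :: "complex vec \<Rightarrow> complex vec \<Rightarrow> complex vec" where
  "kron_vec u v = vec (dim_vec u * dim_vec v) (\<lambda>i. u $ (i div dim_vec v) * v $ (i mod dim_vec v))"

definition mat_exp :: "complex mat \<Rightarrow> complex mat" where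
  "mat_exp A = mat (dim_row A) (dim_col A) (\<lambda>(i, j). \<Sum>m. (A ^\<^sub>m m) $$ (i, j) / fact m)"

definition unitary :: "nat \<Rightarrow> complex mat \<Rightarrow> bool" where
  "unitary d U \<longleftrightarrow> U \<in> carrier_mat d d \<and> mat_adjoint U * U = 1\<^sub>m d"

text \<open>The projector on the basis state \<open>|b\<rangle>\<close> of one qubit, where \<open>False\<close> stands for 0.\<close>

definition proj :: "bool \<Rightarrow> complex mat" where
  "proj b = mat 2 2 (\<lambda>(i, j). if i = j \<and> i = of_bool b then 1 else 0)"

definition pauli_X :: "complex mat" where
  "pauli_X = mat 2 2 (\<lambda>(i, j). if i \<noteq> j then 1 else 0)"

text \<open>In a register of \<open>m\<close> qubits, qubit 0 is the leftmost tensor factor.\<close>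

definition on_qubit :: "nat \<Rightarrow> nat \<Rightarrow> complex mat \<Rightarrow> complex mat" where
  "on_qubit m q A = kron (kron (1\<^sub>m (2 ^ q)) A) (1\<^sub>m (2 ^ (m - 1 - q)))"

text \<open>
  A circuit acts on \<open>k\<close> ancilla qubits, numbered \<open>0, \<dots>, k - 1\<close>, followed by the \<open>n\<close> system
  qubits, numbered \<open>k, \<dots>, k + n - 1\<close>. The elementary gates are arbitrary one-qubit unitaries
  and CNOT gates, on any of the qubits. A controlled evolution is controlled by an ancilla and
  acts on the whole system register; the Hamiltonian is not part of the description of the circuit.
\<close>

datatype instr =
    Gate1 "complex mat" nat
  | CNOT nat nat   \<comment> \<open>control, target\<close>
  | CEvol nat real \<comment> \<open>control, evolution time\<close>
  | Measure nat

datatype circuit = Circuit (ancillas: nat) (instrs: "instr list")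

fun valid_instr :: "nat \<Rightarrow> nat \<Rightarrow> instr \<Rightarrow> bool" where
  "valid_instr k n (Gate1 U q) \<longleftrightarrow> unitary 2 U \<and> q < k + n"
| "valid_instr k n (CNOT c q) \<longleftrightarrow> c < k + n \<and> q < k + n \<and> c \<noteq> q"
| "valid_instr k n (CEvol c t) \<longleftrightarrow> c < k"
| "valid_instr k n (Measure q) \<longleftrightarrow> q < k + n"

definition valid_circuit :: "nat \<Rightarrow> circuit \<Rightarrow> bool" where
  "valid_circuit n c \<longleftrightarrow> ancillas c \<ge> 1 \<and> (\<forall>i\<in>set (instrs c). valid_instr (ancillas c) n i)"

fun instr_time :: "instr \<Rightarrow> real" where
  "instr_time (CEvol c t) = \<bar>t\<bar>"
| "instr_time _ = 0"

fun instr_gates :: "instr \<Rightarrow> nat" where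
  "instr_gates (Gate1 U q) = 1"
| "instr_gates (CNOT c q) = 1"
| "instr_gates _ = 0"

definition evolution_time :: "circuit \<Rightarrow> real" where
  "evolution_time c = sum_list (map instr_time (instrs c))"

definition gate_count :: "circuit \<Rightarrow> nat" where
  "gate_count c = sum_list (map instr_gates (instrs c))"

definition controlled_evolution :: "nat \<Rightarrow> nat \<Rightarrow> complex mat \<Rightarrow> nat \<Rightarrow> real \<Rightarrow> complex mat" where
  "controlled_evolution k n H c t =
     kron (on_qubit k c (proj False)) (1\<^sub>m (2 ^ n)) +
     kron (on_qubit k c (proj True)) (mat_exp ((\<i> * of_real t) \<cdot>\<^sub>m H))"

definition cnot :: "nat \<Rightarrow> nat \<Rightarrow> nat \<Rightarrow> complex mat" where
  "cnot m c q = on_qubit m c (proj False) + on_qubit m c (proj True) * on_qubit m q pauli_X"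

definition sq_norm :: "complex vec \<Rightarrow> real" where
  "sq_norm v = Re (v \<bullet>c v)"

definition normalize_vec :: "complex vec \<Rightarrow> complex vec" where
  "normalize_vec v = of_real (1 / sqrt (sq_norm v)) \<cdot>\<^sub>v v"

text \<open>
  The distribution of the measurement outcomes, in the order of the measurements, when the
  instructions are applied to a unit vector.
\<close>

fun run_instrs :: "nat \<Rightarrow> nat \<Rightarrow> complex mat \<Rightarrow> instr list \<Rightarrow> complex vec \<Rightarrow> bool list pmf" where
  "run_instrs k n H [] v = return_pmf []"
| "run_instrs k n H (Gate1 U q # is) v = run_instrs k n H is (on_qubit (k + n) q U *\<^sub>v v)"
| "run_instrs k n H (CNOT c q # is) v = run_instrs k n H is (cnot (k + n) c q *\<^sub>v v)"
| "run_instrs k n H (CEvol c t # is) v = run_instrs k n H is (controlled_evolution k n H c t *\<^sub>v v)"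
| "run_instrs k n H (Measure q # is) v =
     bind_pmf (bernoulli_pmf (sq_norm (on_qubit (k + n) q (proj True) *\<^sub>v v)))
       (\<lambda>b. map_pmf (Cons b)
          (run_instrs k n H is (normalize_vec (on_qubit (k + n) q (proj b) *\<^sub>v v))))"

definition run_circuit :: "nat \<Rightarrow> complex mat \<Rightarrow> complex vec \<Rightarrow> circuit \<Rightarrow> bool list pmf" where
  "run_circuit n H \<psi> c =
     run_instrs (ancillas c) n H (instrs c) (kron_vec (unit_vec (2 ^ ancillas c) 0) \<psi>)"

text \<open>
  A randomised classical procedure that may choose each circuit depending on the outcomes of the
  previous ones. It interacts with the Hamiltonian and the state only through these outcomes.
\<close>

datatype algorithm =
    Output real
  | Sample "algorithm pmf"
  | Query circuit "bool list \<Rightarrow> algorithm"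

text \<open>The joint distribution of the list of executed circuits and the output.\<close>

primrec run_algorithm ::
  "nat \<Rightarrow> complex mat \<Rightarrow> complex vec \<Rightarrow> algorithm \<Rightarrow> (circuit list \<times> real) pmf" where
  "run_algorithm n H \<psi> (Output x) = return_pmf ([], x)"
| "run_algorithm n H \<psi> (Sample p) = join_pmf (map_pmf (run_algorithm n H \<psi>) p)"
| "run_algorithm n H \<psi> (Query c f) =
     bind_pmf (run_circuit n H \<psi> c)
       (\<lambda>bs. map_pmf (\<lambda>(cs, x). (c # cs, x)) (run_algorithm n H \<psi> (f bs)))"

definition spectral_decomposition ::
  "nat \<Rightarrow> complex mat \<Rightarrow> (nat \<Rightarrow> real) \<Rightarrow> (nat \<Rightarrow> complex vec) \<Rightarrow> bool" where
  "spectral_decomposition N H E \<phi> \<longleftrightarrow>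
     (\<forall>j<N. \<phi> j \<in> carrier_vec N) \<and>
     (\<forall>i<N. \<forall>j<N. \<phi> i \<bullet>c \<phi> j = (if i = j then 1 else 0)) \<and>
     H = mat N N (\<lambda>(a, b). \<Sum>j<N. of_real (E j) * \<phi> j $ a * cnj (\<phi> j $ b))"

text \<open>Logarithms in the bounds are read as being at least 1.\<close>

definition log1 :: "real \<Rightarrow> real" where
  "log1 x = max 1 (ln x)"

text \<open>\<open>g \<le> soft_O C p f\<close> with constants \<open>C\<close> and \<open>p\<close> says that \<open>g\<close> is
  \<open>f\<close> up to factors polylogarithmic in \<open>f\<close>.\<close>

definition soft_O :: "real \<Rightarrow> nat \<Rightarrow> real \<Rightarrow> real" where
  "soft_O C p f = C * f * log1 f ^ p"

end

theory Submission
  imports Defs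
begin

text \<open>
  With one ancilla, a Hadamard test for time \<open>t\<close> and phase \<open>\<alpha>\<close> acts diagonally in the eigenbasis of
  \<open>H\<close>, so a sequence of tests on the same system register behaves as if an eigenstate \<open>j\<close> were
  drawn with probability \<open>|\<gamma>\<^sub>j|\<^sup>2\<close> and the tests were independent coins with bias
  \<open>(1 + cos (t E\<^sub>j + \<alpha>)) / 2\<close>. Repeated tests at the times \<open>1, 2, 4, \<dots>, 2\<^sup>L\<close>
  determine \<open>E\<^sub>j\<close> up to \<open>O(2\<^sup>-\<^sup>L)\<close> with exponentially small error.

  Let \<open>W\<close> be the maximum of \<open>\<epsilon>\<close> and the known multiple \<open>D \<le> \<epsilon>\<^sup>\<beta> \<Delta>\<^sub>t\<^sub>r\<^sub>u\<^sub>e\<^sup>1\<^sup>-\<^sup>\<beta>\<close> of \<open>\<Delta>\<close>.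
  A low quantile of such estimates over \<open>O(\<eta>\<^sup>-\<^sup>1 log \<delta>\<^sup>-\<^sup>1)\<close> circuits locates \<open>E\<^sub>0\<close> up to \<open>W / 4\<close>.
  If \<open>\<epsilon> < D\<close>, then \<open>D\<close> is at most the gap. In that case one more test, at time \<open>1 / W\<close>, is
  placed in front of the sequence, and only runs whose estimate is near \<open>E\<^sub>0\<close> are kept. Excited states
  survive with probability at most \<open>\<epsilon>\<eta> / (64 W)\<close>, so the frequency of the extra outcome among the
  \<open>\<Omega>((W / \<epsilon>)\<^sup>2 log \<delta>\<^sup>-\<^sup>1)\<close> kept runs gives \<open>E\<^sub>0\<close> up to \<open>\<epsilon>\<close>.
\<close>

subsection \<open>Independent samples and tail bounds\<close>

text \<open>The distributions may differ, so that one notion covers the tests within a run, which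
  have different biases, and identical repeated runs.\<close>

primrec seq_pmf :: "'a pmf list \<Rightarrow> 'a list pmf" where
  "seq_pmf [] = return_pmf []"
| "seq_pmf (p # ps) = bind_pmf p (\<lambda>x. map_pmf (Cons x) (seq_pmf ps))"

lemma pmf_map_Cons: "pmf (map_pmf (Cons c) p) (d # ds) = (if c = d then pmf p ds else 0)"
proof (cases "c = d")
  case True
  have "inj (Cons d)" by (simp add: inj_def)
  then show ?thesis using True pmf_map_inj'[of "Cons d" p ds] by simp
next
  case False
  have "d # ds \<notin> set_pmf (map_pmf (Cons c) p)" using False by auto
  then show ?thesis using False by (simp add: pmf_eq_0_set_pmf)
qed

lemma pmf_map_Cons_Nil: "pmf (map_pmf (Cons c) p) [] = 0"
  by (auto simp: pmf_eq_0_set_pmf)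

lemma integrable_pmf_bounded:
  fixes f :: "'a \<Rightarrow> real"
  assumes "\<And>x. \<bar>f x\<bar> \<le> B"
  shows "integrable (measure_pmf p) f"
  by (rule measure_pmf.integrable_const_bound[where B = B]) (use assms in auto)

lemma prob_bind_pmf:
  "measure_pmf.prob (bind_pmf p f) A = measure_pmf.expectation p (\<lambda>x. measure_pmf.prob (f x) A)"
proof -
  have "measure_pmf.expectation p (\<lambda>x. measure_pmf.prob (f x) A)
      = enn2real (\<integral>\<^sup>+x. ennreal (measure_pmf.prob (f x) A) \<partial>measure_pmf p)"
    by (rule integral_eq_nn_integral) auto
  also have "\<dots> = enn2real (emeasure (bind_pmf p f) A)"
    by (simp add: measure_pmf.emeasure_eq_measure[symmetric])
  finally show ?thesis unfolding Sigma_Algebra.measure_def[of "measure_pmf (bind_pmf p f)"] by (rule sym)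
qed

text \<open>Chains two stages: missing the good set \<open>G\<close> costs \<open>a\<close>, failing
  from inside \<open>G\<close> costs \<open>b\<close>.\<close>

lemma prob_bind_pmf_le:
  assumes "\<And>x. x \<in> G \<Longrightarrow> measure_pmf.prob (f x) A \<le> b" and "measure_pmf.prob p (- G) \<le> a"
    and "0 \<le> b"
  shows "measure_pmf.prob (bind_pmf p f) A \<le> a + b"
proof -
  have "measure_pmf.prob (bind_pmf p f) A \<le> measure_pmf.expectation p (\<lambda>x. indicator (- G) x + b)"
    unfolding prob_bind_pmf
  proof (rule integral_mono)
    show "integrable (measure_pmf p) (\<lambda>x. measure_pmf.prob (f x) A)"
      by (rule integrable_pmf_bounded[where B = 1]) simp
    show "integrable (measure_pmf p) (\<lambda>x. indicator (- G) x + b)"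
      by (rule integrable_pmf_bounded[where B = "1 + b"]) (use assms(3) in \<open>auto simp: indicator_def\<close>)
    show "measure_pmf.prob (f x) A \<le> indicator (- G) x + b" for x
      using assms(1)[of x] assms(3) add_mono[OF measure_pmf.prob_le_1[of "f x" A] assms(3)]
      by (cases "x \<in> G") simp_all
  qed
  also have "\<dots> = measure_pmf.prob p (- G) + b"
    by (subst Bochner_Integration.integral_add) (auto intro!: integrable_pmf_bounded[where B = 1] simp: indicator_def)
  finally show ?thesis using assms(2) by simp
qed

text \<open>Nonnegative integrals over the counting measure carry the pointwise identity to
  arbitrary events without a summability argument.\<close>

lemma prob_mixture:
  assumes "finite I" and w: "\<And>j. j \<in> I \<Longrightarrow> 0 \<le> w j"
    and eq: "\<And>x. pmf P x = (\<Sum>j\<in>I. w j * pmf (Q j) x)"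
  shows "measure_pmf.prob P A = (\<Sum>j\<in>I. w j * measure_pmf.prob (Q j) A)"
proof -
  have em: "emeasure (measure_pmf R) A = (\<integral>\<^sup>+x. ennreal (pmf R x) * indicator A x \<partial>count_space UNIV)" for R :: "'b pmf"
    using nn_integral_measure_pmf[of R "indicator A"] by simp
  have "emeasure (measure_pmf P) A
      = (\<integral>\<^sup>+x. (\<Sum>j\<in>I. ennreal (w j) * (ennreal (pmf (Q j) x) * indicator A x)) \<partial>count_space UNIV)"
    unfolding em eq
    by (intro nn_integral_cong)
      (simp add: sum_ennreal[symmetric] w ennreal_mult sum_distrib_right mult.assoc)
  also have "\<dots> = (\<Sum>j\<in>I. ennreal (w j) * emeasure (measure_pmf (Q j)) A)"
    by (subst nn_integral_sum) (auto simp: em nn_integral_cmult)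
  also have "\<dots> = ennreal (\<Sum>j\<in>I. w j * measure_pmf.prob (Q j) A)"
    by (subst sum_ennreal[symmetric]) (auto simp: w ennreal_mult measure_pmf.emeasure_eq_measure)
  finally show ?thesis
    by (simp add: measure_pmf.emeasure_eq_measure w sum_nonneg)
qed

section \<open>Exponential moments and Bernstein-type tail bounds\<close>

lemma exp_le_quadratic:
  fixes x :: real
  assumes "\<bar>x\<bar> \<le> 1"
  shows "exp x \<le> 1 + x + x\<^sup>2"
proof (cases "0 \<le> x")
  case True
  then show ?thesis using exp_bound[of x] assms by simp
next
  case False
  define y where "y = - x"
  have y: "0 \<le> y" "y \<le> 1" using False assms by (auto simp: y_def)
  have 1: "1 + y + y\<^sup>2 / 2 \<le> exp y" using exp_lower_Taylor_quadratic[OF y(1)] .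
  have pos: "0 < 1 - y + y\<^sup>2" using y by (smt (verit) power2_eq_square zero_less_power2 mult_pos_pos zero_le_power2)
  \<comment> \<open>A lower bound for \<open>exp y\<close> becomes an upper bound for
    \<open>exp (- y)\<close> once this product is at least 1; its linear terms cancel and no
    negative term remains.\<close>
  have "1 \<le> (1 - y + y\<^sup>2) * (1 + y + y\<^sup>2 / 2)"
  proof -
    have "(1 - y + y\<^sup>2) * (1 + y + y\<^sup>2 / 2) = 1 + (y^2 + y^3 + y^4) / 2"
      by (simp add: field_simps eval_nat_numeral)
    then show ?thesis using y by simp
  qed
  also have "\<dots> \<le> (1 - y + y\<^sup>2) * exp y" using 1 pos by simp
  finally have "exp (- y) \<le> 1 - y + y\<^sup>2"
    by (simp add: exp_minus field_simps)
  then show ?thesis by (simp add: y_def)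
qed

text \<open>The second moment \<open>V\<close> enters, not just the range of \<open>f\<close>. For
  rare events this makes exponents proportional to their probability, which keeps the number of runs
  linear in \<open>1 / \<eta>\<close>.\<close>

lemma mgf_le:
  fixes f :: "'a \<Rightarrow> real"
  assumes f: "\<And>x. \<bar>f x\<bar> \<le> 1" and m: "measure_pmf.expectation p f \<le> m"
    and V: "measure_pmf.expectation p (\<lambda>x. (f x)\<^sup>2) \<le> V" and l: "0 \<le> l" "l \<le> 1"
  shows "measure_pmf.expectation p (\<lambda>x. exp (l * f x)) \<le> exp (l * m + l\<^sup>2 * V)"
proof -
  have b: "\<bar>l * f x\<bar> \<le> 1" for x
    using mult_mono[OF l(2) f[of x]] l by (simp add: abs_mult)
  have i1: "integrable (measure_pmf p) f" by (rule integrable_pmf_bounded[OF f])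
  have i2: "integrable (measure_pmf p) (\<lambda>x. (f x)\<^sup>2)"
    by (rule integrable_pmf_bounded[where B = 1]) (use f in \<open>simp add: abs_square_le_1\<close>)
  have "measure_pmf.expectation p (\<lambda>x. exp (l * f x))
      \<le> measure_pmf.expectation p (\<lambda>x. 1 + l * f x + l\<^sup>2 * (f x)\<^sup>2)"
  proof (rule integral_mono)
    show "integrable (measure_pmf p) (\<lambda>x. exp (l * f x))"
      by (rule integrable_pmf_bounded[where B = "exp 1"]) (use b in \<open>smt (verit) exp_ge_zero exp_le_cancel_iff abs_exp_cancel\<close>)
    show "integrable (measure_pmf p) (\<lambda>x. 1 + l * f x + l\<^sup>2 * (f x)\<^sup>2)"
      using i1 i2 by auto
    show "exp (l * f x) \<le> 1 + l * f x + l\<^sup>2 * (f x)\<^sup>2" for x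
      using exp_le_quadratic[OF b[of x]] by (simp add: power_mult_distrib)
  qed
  also have "\<dots> = 1 + l * measure_pmf.expectation p f + l\<^sup>2 * measure_pmf.expectation p (\<lambda>x. (f x)\<^sup>2)"
    using i1 i2 by simp
  also have "\<dots> \<le> 1 + (l * m + l\<^sup>2 * V)"
    using mult_left_mono[OF m l(1)] mult_left_mono[OF V zero_le_power2[of l]] by simp
  also have "\<dots> \<le> exp (l * m + l\<^sup>2 * V)" by (rule exp_ge_add_one_self)
  finally show ?thesis .
qed

text \<open>The exponential Markov inequality, by induction: the value of the first draw moves into
  the threshold. The tilt is part of \<open>f\<close> and may vary with the position.\<close>

lemma chernoff_seq_pmf:
  fixes f :: "nat \<Rightarrow> 'a \<Rightarrow> real"
  assumes "\<And>i x. i < length ps \<Longrightarrow> \<bar>f i x\<bar> \<le> 1"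
    and "\<And>i. i < length ps \<Longrightarrow> measure_pmf.expectation (ps ! i) (\<lambda>x. exp (f i x)) \<le> exp (v i)"
  shows "measure_pmf.prob (seq_pmf ps) {xs. a \<le> (\<Sum>i<length ps. f i (xs ! i))}
    \<le> exp ((\<Sum>i<length ps. v i) - a)"
  using assms
proof (induction ps arbitrary: f v a)
  case Nil
  then show ?case by (simp add: indicator_def)
next
  case (Cons p ps)
  let ?V = "\<Sum>i<length ps. v (Suc i)"
  have IH: "measure_pmf.prob (seq_pmf ps) {xs. b \<le> (\<Sum>i<length ps. f (Suc i) (xs ! i))} \<le> exp (?V - b)" for b
    using Cons.prems(1)[of "Suc _"] Cons.prems(2)[of "Suc _"]
    by (intro Cons.IH[of "\<lambda>i. f (Suc i)" "\<lambda>i. v (Suc i)"]) auto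
  have int: "integrable (measure_pmf p) (\<lambda>x. exp (f 0 x))"
    by (rule integrable_pmf_bounded[where B = "exp 1"])
      (use Cons.prems(1)[of 0] in \<open>smt (verit) exp_ge_zero exp_le_cancel_iff abs_exp_cancel length_Cons zero_less_Suc\<close>)
  have "measure_pmf.prob (seq_pmf (p # ps)) {xs. a \<le> (\<Sum>i<length (p # ps). f i (xs ! i))}
      = measure_pmf.expectation p (\<lambda>x. measure_pmf.prob (seq_pmf ps)
          {xs. a - f 0 x \<le> (\<Sum>i<length ps. f (Suc i) (xs ! i))})"
    by (simp add: prob_bind_pmf vimage_def sum.lessThan_Suc_shift algebra_simps del: sum.lessThan_Suc)
  also have "\<dots> \<le> measure_pmf.expectation p (\<lambda>x. exp (?V - a) * exp (f 0 x))"
  proof (rule integral_mono)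
    show "integrable (measure_pmf p) (\<lambda>x. measure_pmf.prob (seq_pmf ps)
          {xs. a - f 0 x \<le> (\<Sum>i<length ps. f (Suc i) (xs ! i))})"
      by (rule integrable_pmf_bounded[where B = 1]) simp
    show "integrable (measure_pmf p) (\<lambda>x. exp (?V - a) * exp (f 0 x))" using int by simp
    show "measure_pmf.prob (seq_pmf ps) {xs. a - f 0 x \<le> (\<Sum>i<length ps. f (Suc i) (xs ! i))}
        \<le> exp (?V - a) * exp (f 0 x)" for x
      using IH[of "a - f 0 x"] by (simp add: exp_add[symmetric] algebra_simps)
  qed
  also have "\<dots> = exp (?V - a) * measure_pmf.expectation p (\<lambda>x. exp (f 0 x))" by simp
  also have "\<dots> \<le> exp (?V - a) * exp (v 0)"
    using Cons.prems(2)[of 0] by (intro mult_left_mono) auto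
  also have "\<dots> = exp ((\<Sum>i<length (p # ps). v i) - a)"
    by (simp add: exp_add[symmetric] sum.lessThan_Suc_shift algebra_simps del: sum.lessThan_Suc)
  finally show ?case .
qed

lemma bernstein_replicate:
  fixes f :: "'a \<Rightarrow> real"
  assumes f: "\<And>x. \<bar>f x\<bar> \<le> 1" and m: "measure_pmf.expectation p f \<le> m"
    and V: "measure_pmf.expectation p (\<lambda>x. (f x)\<^sup>2) \<le> V" and l: "0 \<le> l" "l \<le> 1"
  shows "measure_pmf.prob (seq_pmf (replicate M p)) {xs. a \<le> (\<Sum>i<M. f (xs ! i))}
    \<le> exp (M * (l * m + l\<^sup>2 * V) - l * a)"
proof -
  have b: "\<bar>l * f x\<bar> \<le> 1" for x
    using mult_mono[OF l(2) f[of x]] l by (simp add: abs_mult)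
  have "measure_pmf.prob (seq_pmf (replicate M p)) {xs. a \<le> (\<Sum>i<M. f (xs ! i))}
      \<le> measure_pmf.prob (seq_pmf (replicate M p)) {xs. l * a \<le> (\<Sum>i<length (replicate M p). l * f (xs ! i))}"
    by (intro measure_pmf.finite_measure_mono)
      (use l in \<open>auto simp: sum_distrib_left[symmetric] intro: mult_left_mono\<close>)
  also have "\<dots> \<le> exp ((\<Sum>i<length (replicate M p). l * m + l\<^sup>2 * V) - l * a)"
    using mgf_le[OF f m V l] by (intro chernoff_seq_pmf) (use b in auto)
  finally show ?thesis by simp
qed

subsection \<open>States of one ancilla and the system\<close>

lemma sum_lessThan_double: "(\<Sum>k<2 * N. f k) = (\<Sum>k<N. f k) + (\<Sum>k<N. f (N + k))"
  for f :: "nat \<Rightarrow> 'a :: comm_monoid_add"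
  using sum.atLeastLessThan_concat[of 0 N "2 * N" f] sum.shift_bounds_nat_ivl[of f 0 N N]
  by (simp add: atLeast0LessThan mult_2 add.commute)

lemma kron_one_left: "A \<in> carrier_mat 2 2 \<Longrightarrow> kron (1\<^sub>m (2 ^ 0)) A = A"
  unfolding kron_def by (intro eq_matI) auto

lemma kron_one_right: "A \<in> carrier_mat 2 2 \<Longrightarrow> kron A (1\<^sub>m (2 ^ 0)) = A"
  unfolding kron_def by (intro eq_matI) auto

lemma on_qubit_single: "A \<in> carrier_mat 2 2 \<Longrightarrow> on_qubit 1 0 A = A"
  unfolding on_qubit_def by (simp add: kron_one_left[simplified] kron_one_right[simplified])

lemma on_qubit_first: "A \<in> carrier_mat 2 2 \<Longrightarrow> on_qubit (1 + n) 0 A = kron A (1\<^sub>m (2 ^ n))"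
  unfolding on_qubit_def by (simp add: kron_one_left[simplified])

lemma sq_norm_eq_sum: "sq_norm v = (\<Sum>i<dim_vec v. (cmod (v $ i))\<^sup>2)"
  unfolding cmod_power2
  by (simp add: sq_norm_def scalar_prod_def atLeast0LessThan power2_eq_square sum.distrib)

section \<open>Functional calculus and coordinates in an eigenbasis\<close>

locale eigenbasis =
  fixes n :: nat and H :: "complex mat" and E :: "nat \<Rightarrow> real" and \<phi> :: "nat \<Rightarrow> complex vec"
  assumes spectral: "spectral_decomposition (2 ^ n) H E \<phi>"
begin

abbreviation N :: nat where "N \<equiv> 2 ^ n"

text \<open>The functional calculus of \<open>H\<close>, with \<open>f\<close> given on indices
  rather than on eigenvalues, so that repeated eigenvalues need no special care.\<close>

definition spectral_fun :: "(nat \<Rightarrow> complex) \<Rightarrow> complex mat" where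
  "spectral_fun f = mat N N (\<lambda>(x, y). \<Sum>j<N. f j * \<phi> j $ x * cnj (\<phi> j $ y))"

definition eigen_comb :: "(nat \<Rightarrow> complex) \<Rightarrow> complex vec" where
  "eigen_comb a = vec N (\<lambda>x. \<Sum>j<N. a j * \<phi> j $ x)"

lemma orthonormal: "i < N \<Longrightarrow> j < N \<Longrightarrow> (\<Sum>x<N. \<phi> i $ x * cnj (\<phi> j $ x)) = (if i = j then 1 else 0)"
proof -
  assume ij: "i < N" "j < N"
  then have "\<phi> i \<bullet>c \<phi> j = (if i = j then 1 else 0)" and "\<phi> i \<in> carrier_vec N" "\<phi> j \<in> carrier_vec N"
    using spectral unfolding spectral_decomposition_def by auto
  then show ?thesis by (simp add: scalar_prod_def atLeast0LessThan)
qed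

lemma orthonormal': "i < N \<Longrightarrow> j < N \<Longrightarrow> (\<Sum>x<N. cnj (\<phi> i $ x) * \<phi> j $ x) = (if i = j then 1 else 0)"
  using orthonormal[of j i] by (simp add: mult.commute)

lemma func_mult_comb_entry:
  assumes "x < N"
  shows "(\<Sum>y<N. (\<Sum>j<N. f j * \<phi> j $ x * cnj (\<phi> j $ y)) * (\<Sum>k<N. a k * \<phi> k $ y))
    = (\<Sum>j<N. f j * a j * \<phi> j $ x)"
proof -
  have "(\<Sum>y<N. (\<Sum>j<N. f j * \<phi> j $ x * cnj (\<phi> j $ y)) * (\<Sum>k<N. a k * \<phi> k $ y))
      = (\<Sum>y<N. \<Sum>j<N. \<Sum>k<N. f j * a k * \<phi> j $ x * (cnj (\<phi> j $ y) * \<phi> k $ y))"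
    unfolding sum_product by (simp add: mult_ac)
  also have "\<dots> = (\<Sum>j<N. \<Sum>k<N. \<Sum>y<N. f j * a k * \<phi> j $ x * (cnj (\<phi> j $ y) * \<phi> k $ y))"
    by (subst sum.swap, rule sum.cong, simp, subst sum.swap, simp)
  also have "\<dots> = (\<Sum>j<N. \<Sum>k<N. f j * a k * \<phi> j $ x * (\<Sum>y<N. cnj (\<phi> j $ y) * \<phi> k $ y))"
    by (simp add: sum_distrib_left)
  also have "\<dots> = (\<Sum>j<N. \<Sum>k<N. if j = k then f j * a k * \<phi> j $ x else 0)"
    by (intro sum.cong refl) (simp add: orthonormal')
  also have "\<dots> = (\<Sum>j<N. f j * a j * \<phi> j $ x)"
    by (intro sum.cong refl) (simp add: sum.delta)
  finally show ?thesis .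
qed

lemma func_mult: "spectral_fun f * spectral_fun g = spectral_fun (\<lambda>j. f j * g j)"
proof (intro eq_matI)
  fix x y assume "x < dim_row (spectral_fun (\<lambda>j. f j * g j))" "y < dim_col (spectral_fun (\<lambda>j. f j * g j))"
  then have xy: "x < N" "y < N" by (auto simp: spectral_fun_def)
  have "(spectral_fun f * spectral_fun g) $$ (x, y)
      = (\<Sum>z<N. (\<Sum>j<N. f j * \<phi> j $ x * cnj (\<phi> j $ z)) * (\<Sum>k<N. (g k * cnj (\<phi> k $ y)) * \<phi> k $ z))"
    using xy by (simp add: spectral_fun_def scalar_prod_def atLeast0LessThan mult_ac)
  also have "\<dots> = (\<Sum>j<N. f j * (g j * cnj (\<phi> j $ y)) * \<phi> j $ x)"
    by (rule func_mult_comb_entry) (use xy in simp)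
  finally show "(spectral_fun f * spectral_fun g) $$ (x, y) = spectral_fun (\<lambda>j. f j * g j) $$ (x, y)"
    using xy by (simp add: spectral_fun_def mult_ac)
qed (auto simp: spectral_fun_def)

text \<open>Completeness of the eigenbasis: orthonormality makes \<open>W\<close> a left inverse of
  the square matrix \<open>V\<close>, hence a right inverse, and \<open>V * W\<close> is the
  resolution of the identity.\<close>

lemma func_one: "spectral_fun (\<lambda>j. 1) = 1\<^sub>m N"
proof -
  define V where "V = mat N N (\<lambda>(x, j). \<phi> j $ x)"
  define W where "W = mat N N (\<lambda>(j, x). cnj (\<phi> j $ x))"
  have "W * V = 1\<^sub>m N"
    by (intro eq_matI) (auto simp: V_def W_def scalar_prod_def atLeast0LessThan orthonormal')
  then have "V * W = 1\<^sub>m N"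
    by (intro mat_mult_left_right_inverse[of W N V]) (auto simp: V_def W_def)
  moreover have "V * W = spectral_fun (\<lambda>j. 1)"
    by (intro eq_matI) (auto simp: V_def W_def spectral_fun_def scalar_prod_def atLeast0LessThan)
  ultimately show ?thesis by simp
qed

lemma smult_H_eq_func: "c \<cdot>\<^sub>m H = spectral_fun (\<lambda>j. c * of_real (E j))"
  using spectral unfolding spectral_decomposition_def spectral_fun_def
  by (intro eq_matI) (auto simp: sum_distrib_left mult_ac)

lemma func_pow: "spectral_fun f ^\<^sub>m m = spectral_fun (\<lambda>j. f j ^ m)"
  by (induction m) (simp_all add: func_one func_mult mult.commute, simp add: spectral_fun_def)

text \<open>Powers of \<open>H\<close> act by powers of the eigenvalues, so each entry of the series
  is a finite combination of scalar exponential series.\<close>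

lemma mat_exp_H: "mat_exp (c \<cdot>\<^sub>m H) = spectral_fun (\<lambda>j. exp (c * of_real (E j)))"
proof (intro eq_matI)
  let ?z = "\<lambda>j. c * of_real (E j)"
  fix x y assume "x < dim_row (spectral_fun (\<lambda>j. exp (?z j)))" "y < dim_col (spectral_fun (\<lambda>j. exp (?z j)))"
  then have xy: "x < N" "y < N" by (auto simp: spectral_fun_def)
  have "(\<lambda>m. \<Sum>j<N. (?z j ^ m /\<^sub>R fact m) * (\<phi> j $ x * cnj (\<phi> j $ y)))
      sums (\<Sum>j<N. exp (?z j) * (\<phi> j $ x * cnj (\<phi> j $ y)))"
    by (intro sums_sum sums_mult2 exp_converges)
  moreover have "(\<Sum>j<N. (?z j ^ m /\<^sub>R fact m) * (\<phi> j $ x * cnj (\<phi> j $ y)))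
      = ((c \<cdot>\<^sub>m H) ^\<^sub>m m) $$ (x, y) / fact m" for m
    using xy unfolding smult_H_eq_func func_pow
    by (simp add: spectral_fun_def sum_divide_distrib scaleR_conv_of_real field_simps)
  ultimately have "(\<Sum>m. ((c \<cdot>\<^sub>m H) ^\<^sub>m m) $$ (x, y) / fact m) = (\<Sum>j<N. exp (?z j) * (\<phi> j $ x * cnj (\<phi> j $ y)))"
    by (simp add: sums_iff)
  then show "mat_exp (c \<cdot>\<^sub>m H) $$ (x, y) = spectral_fun (\<lambda>j. exp (?z j)) $$ (x, y)"
    using xy by (simp add: mat_exp_def spectral_fun_def smult_H_eq_func mult_ac)
qed (auto simp: mat_exp_def smult_H_eq_func spectral_fun_def)

text \<open>Parseval's identity.\<close>

lemma sum_cmod_comb: "(\<Sum>x<N. (cmod (eigen_comb a $ x))\<^sup>2) = (\<Sum>j<N. (cmod (a j))\<^sup>2)"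
proof -
  have "complex_of_real (\<Sum>x<N. (cmod (eigen_comb a $ x))\<^sup>2)
      = (\<Sum>x<N. (\<Sum>j<N. a j * \<phi> j $ x) * (\<Sum>k<N. cnj (a k) * cnj (\<phi> k $ x)))"
    by (simp add: eigen_comb_def complex_norm_square del: of_real_power)
  also have "\<dots> = (\<Sum>x<N. \<Sum>j<N. \<Sum>k<N. a j * cnj (a k) * (\<phi> j $ x * cnj (\<phi> k $ x)))"
    unfolding sum_product by (simp add: mult_ac)
  also have "\<dots> = (\<Sum>j<N. \<Sum>k<N. \<Sum>x<N. a j * cnj (a k) * (\<phi> j $ x * cnj (\<phi> k $ x)))"
    by (subst sum.swap, rule sum.cong, simp, subst sum.swap, simp)
  also have "\<dots> = (\<Sum>j<N. \<Sum>k<N. if j = k then a j * cnj (a k) else 0)"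
    by (intro sum.cong refl) (simp add: orthonormal sum_distrib_left[symmetric])
  also have "\<dots> = complex_of_real (\<Sum>j<N. (cmod (a j))\<^sup>2)"
    by (simp add: sum.delta complex_norm_square del: of_real_power)
  finally show ?thesis by (simp only: of_real_eq_iff)
qed

text \<open>The ancilla is the leftmost tensor factor, so the first \<open>N\<close> entries belong
  to ancilla 0 and the last \<open>N\<close> to ancilla 1. Both halves are given by their
  coordinates in the eigenbasis.\<close>

definition joint_state :: "(nat \<Rightarrow> complex) \<Rightarrow> (nat \<Rightarrow> complex) \<Rightarrow> complex vec" where
  "joint_state a b = vec (2 * N) (\<lambda>i. eigen_comb (if i < N then a else b) $ (i mod N))"

lemma dim_st [simp]: "dim_vec (joint_state a b) = 2 * N"
  by (simp add: joint_state_def)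

lemma sq_norm_st: "sq_norm (joint_state a b) = (\<Sum>j<N. (cmod (a j))\<^sup>2) + (\<Sum>j<N. (cmod (b j))\<^sup>2)"
proof -
  have "sq_norm (joint_state a b) = (\<Sum>i<2 * N. (cmod (joint_state a b $ i))\<^sup>2)"
    by (simp add: sq_norm_eq_sum)
  also have "\<dots> = (\<Sum>x<N. (cmod (eigen_comb a $ x))\<^sup>2) + (\<Sum>x<N. (cmod (eigen_comb b $ x))\<^sup>2)"
    by (simp add: sum_lessThan_double joint_state_def)
  finally show ?thesis by (simp add: sum_cmod_comb)
qed

lemma smult_st: "c \<cdot>\<^sub>v joint_state a b = joint_state (\<lambda>j. c * a j) (\<lambda>j. c * b j)"
  by (intro eq_vecI) (auto simp: joint_state_def eigen_comb_def sum_distrib_left mult_ac)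

lemma add_st: "joint_state a b + joint_state a' b' = joint_state (\<lambda>j. a j + a' j) (\<lambda>j. b j + b' j)"
  by (intro eq_vecI) (auto simp: joint_state_def eigen_comb_def sum.distrib algebra_simps)

lemma st_cong: "(\<And>j. j < N \<Longrightarrow> a j = a' j) \<Longrightarrow> (\<And>j. j < N \<Longrightarrow> b j = b' j) \<Longrightarrow> joint_state a b = joint_state a' b'"
  by (intro eq_vecI) (auto simp: joint_state_def eigen_comb_def intro!: sum.cong)

text \<open>The gates and projections of the tests are sums of such products. In eigenbasis
  coordinates they act on each pair \<open>(a j, b j)\<close> separately.\<close>

lemma kron_func_st:
  assumes "A \<in> carrier_mat 2 2"
  shows "kron A (spectral_fun f) *\<^sub>v joint_state a b =
    joint_state (\<lambda>j. f j * (A $$ (0, 0) * a j + A $$ (0, 1) * b j))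
       (\<lambda>j. f j * (A $$ (1, 0) * a j + A $$ (1, 1) * b j))"
proof (intro eq_vecI)
  fix i assume "i < dim_vec (joint_state (\<lambda>j. f j * (A $$ (0, 0) * a j + A $$ (0, 1) * b j))
       (\<lambda>j. f j * (A $$ (1, 0) * a j + A $$ (1, 1) * b j)))"
  then have i: "i < 2 * N" by simp
  define r where "r = i div N"
  define x where "x = i mod N"
  have x: "x < N" by (simp add: x_def)
  have r: "r < 2" using i by (simp add: r_def less_mult_imp_div_less)
  have ri: "i < N \<longleftrightarrow> r = 0" by (simp add: r_def div_eq_0_iff)
  have entry: "kron A (spectral_fun f) $$ (i, k) = A $$ (r, k div N) * spectral_fun f $$ (x, k mod N)" if "k < 2 * N" for k
    using that i assms by (simp add: kron_def r_def x_def spectral_fun_def)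
  have fe: "(\<Sum>y<N. spectral_fun f $$ (x, y) * eigen_comb c $ y) = eigen_comb (\<lambda>j. f j * c j) $ x" for c
    using func_mult_comb_entry[OF x, of f c] x by (simp add: spectral_fun_def eigen_comb_def)
  have "(kron A (spectral_fun f) *\<^sub>v joint_state a b) $ i = (\<Sum>k<2 * N. kron A (spectral_fun f) $$ (i, k) * joint_state a b $ k)"
    using i assms by (simp add: kron_def scalar_prod_def atLeast0LessThan spectral_fun_def)
  also have "\<dots> = (\<Sum>k<2 * N. A $$ (r, k div N) * spectral_fun f $$ (x, k mod N) * joint_state a b $ k)"
    by (intro sum.cong refl) (simp add: entry)
  also have "\<dots> = A $$ (r, 0) * (\<Sum>y<N. spectral_fun f $$ (x, y) * eigen_comb a $ y)
      + A $$ (r, 1) * (\<Sum>y<N. spectral_fun f $$ (x, y) * eigen_comb b $ y)"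
    by (simp add: sum_lessThan_double sum_distrib_left joint_state_def mult.assoc)
  also have "\<dots> = eigen_comb (\<lambda>j. f j * (A $$ (r, 0) * a j + A $$ (r, 1) * b j)) $ x"
    using x by (simp add: fe) (simp add: eigen_comb_def sum_distrib_left sum.distrib algebra_simps)
  also have "\<dots> = joint_state (\<lambda>j. f j * (A $$ (0, 0) * a j + A $$ (0, 1) * b j))
       (\<lambda>j. f j * (A $$ (1, 0) * a j + A $$ (1, 1) * b j)) $ i"
    using i ri r by (cases "r = 0") (auto simp: joint_state_def x_def less_2_cases_iff)
  finally show "(kron A (spectral_fun f) *\<^sub>v joint_state a b) $ i = joint_state (\<lambda>j. f j * (A $$ (0, 0) * a j + A $$ (0, 1) * b j))
       (\<lambda>j. f j * (A $$ (1, 0) * a j + A $$ (1, 1) * b j)) $ i" .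
qed (use assms in \<open>simp add: kron_def spectral_fun_def\<close>)

lemma on_qubit_st:
  assumes "A \<in> carrier_mat 2 2"
  shows "on_qubit (1 + n) 0 A *\<^sub>v joint_state a b =
    joint_state (\<lambda>j. A $$ (0, 0) * a j + A $$ (0, 1) * b j) (\<lambda>j. A $$ (1, 0) * a j + A $$ (1, 1) * b j)"
  using kron_func_st[OF assms, of "\<lambda>j. 1" a b] by (simp add: on_qubit_first[OF assms, simplified] func_one)

lemma controlled_evolution_st:
  "controlled_evolution 1 n H 0 t *\<^sub>v joint_state a b = joint_state a (\<lambda>j. cis (t * E j) * b j)"
proof -
  let ?f = "\<lambda>j. exp ((\<i> * of_real t) * of_real (E j))"
  have p: "proj c \<in> carrier_mat 2 2" for c by (simp add: proj_def)
  have "controlled_evolution 1 n H 0 t = kron (proj False) (spectral_fun (\<lambda>j. 1)) + kron (proj True) (spectral_fun ?f)"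
    unfolding controlled_evolution_def on_qubit_single[OF p] mat_exp_H func_one ..
  also have "\<dots> *\<^sub>v joint_state a b = kron (proj False) (spectral_fun (\<lambda>j. 1)) *\<^sub>v joint_state a b + kron (proj True) (spectral_fun ?f) *\<^sub>v joint_state a b"
    by (rule add_mult_distrib_mat_vec[of _ "2 * N" "2 * N"]) (auto simp: kron_def proj_def spectral_fun_def intro!: carrier_vecI)
  also have "\<dots> = joint_state a (\<lambda>j. cis (t * E j) * b j)"
    unfolding kron_func_st[OF p] add_st by (intro st_cong) (auto simp: proj_def cis_conv_exp mult_ac)
  finally show ?thesis .
qed

lemma kron_vec_zero_comb: "kron_vec (unit_vec (2 ^ 1) 0) (eigen_comb a) = joint_state a (\<lambda>j. 0)"
proof (intro eq_vecI)
  fix i assume "i < dim_vec (joint_state a (\<lambda>j. 0))"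
  then have i: "i < 2 * N" by simp
  then have "i div N < 2" by (simp add: less_mult_imp_div_less)
  moreover have "i div N = 0 \<longleftrightarrow> i < N" by (simp add: div_eq_0_iff)
  ultimately show "kron_vec (unit_vec (2 ^ 1) 0) (eigen_comb a) $ i = joint_state a (\<lambda>j. 0) $ i"
    using i by (auto simp: kron_vec_def joint_state_def eigen_comb_def)
qed (simp add: kron_vec_def eigen_comb_def)

end

subsection \<open>Hadamard tests\<close>

definition hadamard_prob :: "real \<Rightarrow> real \<times> real \<Rightarrow> real" where
  "hadamard_prob e p = (1 + cos (fst p * e + snd p)) / 2"

lemma half_one_plus_bounds: "- 1 \<le> c \<Longrightarrow> c \<le> 1 \<Longrightarrow> 0 \<le> (1 + c) / 2 \<and> (1 + c) / 2 \<le> 1"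
  for c :: real
  by simp

lemma hadamard_prob_bounds: "0 \<le> hadamard_prob e p" "hadamard_prob e p \<le> 1"
  using half_one_plus_bounds[OF cos_ge_minus_one cos_le_one] unfolding hadamard_prob_def by blast+

definition tests_pmf :: "(real \<times> real) list \<Rightarrow> real \<Rightarrow> bool list pmf" where
  "tests_pmf ps e = seq_pmf (map (\<lambda>p. bernoulli_pmf (hadamard_prob e p)) ps)"

text \<open>The phase gate \<open>diag (1, cis \<alpha>)\<close> followed by a Hadamard gate, merged
  into one elementary gate; a test then costs two gates.\<close>

definition phase_hadamard :: "real \<Rightarrow> complex mat" where
  "phase_hadamard \<alpha> = mat 2 2 (\<lambda>(i, j). (if j = 0 then 1 else if i = 0 then cis \<alpha> else - cis \<alpha>) / sqrt 2)"

definition test_instrs :: "real \<times> real \<Rightarrow> instr list" where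
  "test_instrs p = [Gate1 (phase_hadamard 0) 0, CEvol 0 (fst p), Gate1 (phase_hadamard (snd p)) 0, Measure 0]"

definition test_circuit :: "(real \<times> real) list \<Rightarrow> circuit" where
  "test_circuit ps = Circuit 1 (concat (map test_instrs ps))"

lemma unitary_phase_hadamard: "unitary 2 (phase_hadamard \<alpha>)"
proof -
  have s: "complex_of_real (sqrt 2) * complex_of_real (sqrt 2) = 2"
    by (simp flip: of_real_mult)
  have c: "cnj (cis \<alpha>) * cis \<alpha> = 1"
    by (simp add: cis_cnj cis_mult)
  have adj: "mat_adjoint (phase_hadamard \<alpha>) = mat 2 2 (\<lambda>(i, j). cnj (phase_hadamard \<alpha> $$ (j, i)))"
    by (rule eq_matI) (auto simp: mat_adjoint_def phase_hadamard_def mat_of_rows_def)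
  have "mat_adjoint (phase_hadamard \<alpha>) * phase_hadamard \<alpha> = 1\<^sub>m 2"
    unfolding adj
    by (rule eq_matI)
      (auto simp: phase_hadamard_def scalar_prod_def s c dest!: less_2_cases simp: numeral_2_eq_2)
  then show ?thesis by (simp add: unitary_def phase_hadamard_def)
qed

lemma valid_test_circuit: "valid_circuit n (test_circuit ps)"
  by (auto simp: valid_circuit_def test_circuit_def test_instrs_def unitary_phase_hadamard)

lemma evolution_time_test_circuit: "evolution_time (test_circuit ps) = (\<Sum>p\<leftarrow>ps. \<bar>fst p\<bar>)"
  by (induction ps) (auto simp: evolution_time_def test_circuit_def test_instrs_def)

lemma gate_count_test_circuit: "gate_count (test_circuit ps) = 2 * length ps"
  by (induction ps) (auto simp: gate_count_def test_circuit_def test_instrs_def)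

text \<open>The ancilla is not reset after a measurement. Started in \<open>s\<close>, a test succeeds if it measures
  \<open>s\<close> again, and the measured bit is the start of the next test.\<close>

primrec decode :: "bool \<Rightarrow> bool list \<Rightarrow> bool list" where
  "decode s [] = []"
| "decode s (b # bs) = (b = s) # decode b bs"

context eigenbasis
begin

definition ancilla_state :: "bool \<Rightarrow> (nat \<Rightarrow> complex) \<Rightarrow> complex vec" where
  "ancilla_state s a = (if s then joint_state (\<lambda>j. 0) a else joint_state a (\<lambda>j. 0))"

text \<open>The unnormalised amplitudes after outcome \<open>d\<close>, where \<open>True\<close>
  means that the ancilla is found where it started.\<close>

definition test_amplitude :: "real \<times> real \<Rightarrow> bool \<Rightarrow> (nat \<Rightarrow> complex) \<Rightarrow> nat \<Rightarrow> complex" where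
  "test_amplitude p d a = (\<lambda>j. (1 + (if d then 1 else - 1) * cis (fst p * E j + snd p)) / 2 * a j)"

lemma cmod_amp: "(cmod (test_amplitude p d a j))\<^sup>2 = pmf (bernoulli_pmf (hadamard_prob (E j) p)) d * (cmod (a j))\<^sup>2"
proof -
  let ?\<theta> = "fst p * E j + snd p"
  have "(cmod ((1 + (if d then 1 else - 1) * cis ?\<theta>) / 2))\<^sup>2 = (1 + (if d then 1 else - 1) * cos ?\<theta>) / 2"
    unfolding cmod_power2
    by (simp add: power_divide power2_sum power2_diff sin_squared_eq) (simp add: field_simps)
  moreover have "pmf (bernoulli_pmf (hadamard_prob (E j) p)) d = (1 + (if d then 1 else - 1) * cos ?\<theta>) / 2"
    using hadamard_prob_bounds[of "E j" p] by (cases d) (simp_all add: hadamard_prob_def field_simps)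
  ultimately show ?thesis
    by (simp only: test_amplitude_def norm_mult power_mult_distrib)
qed

lemma sum_cmod_amp: "(\<Sum>j<N. (cmod (test_amplitude p True a j))\<^sup>2) + (\<Sum>j<N. (cmod (test_amplitude p False a j))\<^sup>2) = (\<Sum>j<N. (cmod (a j))\<^sup>2)"
  unfolding cmod_amp sum.distrib[symmetric]
  using hadamard_prob_bounds by (intro sum.cong refl) (simp add: algebra_simps)

lemma proj_st:
  "on_qubit (1 + n) 0 (proj b) *\<^sub>v joint_state a a' = ancilla_state b (if b then a' else a)"
  by (subst on_qubit_st) (auto simp: proj_def ancilla_state_def intro!: st_cong)

text \<open>Starting the ancilla in 1 instead of 0 flips the relative sign of the two branches and
  thus exchanges the two outcomes. Hence comparing each bit with the previous one, as
  \<open>decode\<close> does, can replace a reset.\<close>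

lemma test_unitary_anc:
  "on_qubit (1 + n) 0 (phase_hadamard (snd p)) *\<^sub>v (controlled_evolution 1 n H 0 (fst p) *\<^sub>v
     (on_qubit (1 + n) 0 (phase_hadamard 0) *\<^sub>v ancilla_state s a)) = joint_state (test_amplitude p (\<not> s) a) (test_amplitude p s a)"
proof -
  have s: "complex_of_real (sqrt 2) * complex_of_real (sqrt 2) = 2"
    by (simp flip: of_real_mult)
  have s': "(x / complex_of_real (sqrt 2)) / complex_of_real (sqrt 2) = x / 2"
    "x * (y / complex_of_real (sqrt 2)) / complex_of_real (sqrt 2) = x * y / 2" for x y
    by (simp_all add: s)
  have p: "phase_hadamard \<alpha> \<in> carrier_mat 2 2" for \<alpha> by (simp add: phase_hadamard_def)
  show ?thesis
  proof (cases s)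
    case True
    show ?thesis
      unfolding ancilla_state_def on_qubit_st[OF p] controlled_evolution_st if_P[OF True]
      by (intro st_cong)
        (use True in \<open>auto simp: phase_hadamard_def test_amplitude_def s s' cis_mult[symmetric] field_simps\<close>)
  next
    case False
    show ?thesis
      unfolding ancilla_state_def on_qubit_st[OF p] controlled_evolution_st if_not_P[OF False]
      by (intro st_cong)
        (use False in \<open>auto simp: phase_hadamard_def test_amplitude_def s s' cis_mult[symmetric] field_simps\<close>)
  qed
qed

lemma run_test_instrs:
  "run_instrs 1 n H (test_instrs p @ is) (ancilla_state s a) =
    bind_pmf (bernoulli_pmf (\<Sum>j<N. (cmod (test_amplitude p (True = s) a j))\<^sup>2))
      (\<lambda>b. map_pmf (Cons b) (run_instrs 1 n H is (normalize_vec (ancilla_state b (test_amplitude p (b = s) a)))))"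
proof -
  have eq: "(if b then test_amplitude p s a else test_amplitude p (\<not> s) a) = test_amplitude p (b = s) a" for b
    by auto
  have sq: "sq_norm (ancilla_state b c) = (\<Sum>j<N. (cmod (c j))\<^sup>2)" for b c
    by (auto simp: ancilla_state_def sq_norm_st)
  show ?thesis
    using test_unitary_anc[of p s a]
    by (simp add: test_instrs_def proj_st[simplified] eq sq)
qed

lemma normalize_anc:
  "normalize_vec (ancilla_state b a) = ancilla_state b (\<lambda>j. of_real (1 / sqrt (\<Sum>j<N. (cmod (a j))\<^sup>2)) * a j)"
  by (auto simp: normalize_vec_def ancilla_state_def sq_norm_st smult_st)

text \<open>Every measurement of a test acts diagonally in the eigenbasis, so the unnormalised weight of
  the \<open>j\<close>th component is multiplied by the outcome probability for the \<open>j\<close>th eigenstate.\<close>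

lemma pmf_run_tests:
  assumes "(\<Sum>j<N. (cmod (a j))\<^sup>2) = 1"
  shows "pmf (map_pmf (decode s) (run_instrs 1 n H (concat (map test_instrs ps)) (ancilla_state s a))) ds
    = (\<Sum>j<N. (cmod (a j))\<^sup>2 * pmf (tests_pmf ps (E j)) ds)"
  using assms
proof (induction ps arbitrary: a s ds)
  case Nil
  then show ?case by (simp add: tests_pmf_def sum_distrib_right[symmetric])
next
  case (Cons p ps)
  define Q where "Q d = (\<Sum>j<N. (cmod (test_amplitude p d a j))\<^sup>2)" for d
  define R where "R b = map_pmf (decode b)
    (run_instrs 1 n H (concat (map test_instrs ps)) (normalize_vec (ancilla_state b (test_amplitude p (b = s) a))))" for b
  have Q0: "0 \<le> Q d" for d by (simp add: Q_def sum_nonneg)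
  have Q1: "Q True + Q False = 1" using sum_cmod_amp Cons.prems by (simp add: Q_def)
  then have QN: "Q (\<not> d) = 1 - Q d" for d by (cases d) auto
  have le: "Q d \<le> 1" for d using Q0[of "\<not> d"] QN[of d] by simp
  \<comment> \<open>Normalisation divides all weights by \<open>Q (b = s)\<close>, and the
    probability of the outcome multiplies it back. If it is zero, there is no normalised state, but
    then every weight vanishes.\<close>
  have R: "Q (b = s) * pmf (R b) es = (\<Sum>j<N. (cmod (test_amplitude p (b = s) a j))\<^sup>2 * pmf (tests_pmf ps (E j)) es)" for b es
  proof (cases "Q (b = s) = 0")
    case True
    then have "\<forall>j\<in>{..<N}. (cmod (test_amplitude p (b = s) a j))\<^sup>2 = 0"
      unfolding Q_def by (subst (asm) sum_nonneg_eq_0_iff) auto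
    then have "(\<Sum>j<N. (cmod (test_amplitude p (b = s) a j))\<^sup>2 * pmf (tests_pmf ps (E j)) es) = 0"
      by (intro sum.neutral) simp
    then show ?thesis using True by simp
  next
    case False
    let ?q = "Q (b = s)"
    let ?a = "\<lambda>j. of_real (1 / sqrt ?q) * test_amplitude p (b = s) a j"
    have pos: "?q > 0" using False Q0[of "b = s"] by simp
    have sq: "(cmod (?a j))\<^sup>2 = (cmod (test_amplitude p (b = s) a j))\<^sup>2 / ?q" for j
      using pos by (simp add: norm_mult norm_divide power_mult_distrib power_divide)
    have "(\<Sum>j<N. (cmod (?a j))\<^sup>2) = 1"
      unfolding sq sum_divide_distrib[symmetric] using pos by (simp add: Q_def)
    then have "pmf (R b) es = (\<Sum>j<N. (cmod (?a j))\<^sup>2 * pmf (tests_pmf ps (E j)) es)"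
      unfolding R_def normalize_anc Q_def by (rule Cons.IH)
    then show ?thesis
      unfolding sq using pos by (simp add: sum_distrib_left)
  qed
  have L: "map_pmf (decode s) (run_instrs 1 n H (concat (map test_instrs (p # ps))) (ancilla_state s a))
      = bind_pmf (bernoulli_pmf (Q (True = s))) (\<lambda>b. map_pmf (Cons (b = s)) (R b))"
    using run_test_instrs[of p "concat (map test_instrs ps)" s a]
    by (simp add: map_bind_pmf map_pmf_comp o_def R_def Q_def)
  show ?case
  proof (cases ds)
    case Nil
    then show ?thesis
      unfolding L by (simp add: pmf_bind pmf_map_Cons_Nil tests_pmf_def)
  next
    case (Cons d es)
    have "pmf (tests_pmf (p # ps) e) ds = pmf (bernoulli_pmf (hadamard_prob e p)) d * pmf (tests_pmf ps e) es" for e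
      using hadamard_prob_bounds[of e p]
      by (cases d) (simp_all add: Cons tests_pmf_def pmf_bind pmf_map_Cons)
    then have 1: "(cmod (a j))\<^sup>2 * pmf (tests_pmf (p # ps) (E j)) ds = (cmod (test_amplitude p d a j))\<^sup>2 * pmf (tests_pmf ps (E j)) es" for j
      by (simp add: cmod_amp)
    \<comment> \<open>The decoded outcome \<open>d\<close> comes from the measured bit
      \<open>d = s\<close>.\<close>
    have eq: "((d = s) = s) = d" by auto
    have "pmf (map_pmf (decode s) (run_instrs 1 n H (concat (map test_instrs (p # ps))) (ancilla_state s a))) ds
        = Q d * pmf (R (d = s)) es"
      unfolding L using Q0[of "True = s"] le[of "True = s"] QN[of s]
      by (cases d; cases s) (simp_all add: Cons pmf_bind pmf_map_Cons)
    then show ?thesis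
      using R[of "d = s" es] unfolding 1 eq by simp
  qed
qed

text \<open>Coherence between eigenstates is invisible to the tests: a run is a classical mixture
  over the eigenstates.\<close>

lemma prob_run_test_circuit:
  assumes "sq_norm (eigen_comb \<gamma>) = 1"
  shows "measure_pmf.prob (map_pmf (decode False) (run_circuit n H (eigen_comb \<gamma>) (test_circuit ps))) A
    = (\<Sum>j<N. (cmod (\<gamma> j))\<^sup>2 * measure_pmf.prob (tests_pmf ps (E j)) A)"
proof -
  have "sq_norm (eigen_comb \<gamma>) = (\<Sum>x<N. (cmod (eigen_comb \<gamma> $ x))\<^sup>2)"
    by (simp add: sq_norm_eq_sum eigen_comb_def)
  then have 1: "(\<Sum>j<N. (cmod (\<gamma> j))\<^sup>2) = 1" using assms sum_cmod_comb[of \<gamma>] by simp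
  have run: "run_circuit n H (eigen_comb \<gamma>) (test_circuit ps) = run_instrs 1 n H (concat (map test_instrs ps)) (ancilla_state False \<gamma>)"
    by (simp add: run_circuit_def test_circuit_def ancilla_state_def kron_vec_zero_comb[simplified])
  show ?thesis
    unfolding run by (rule prob_mixture) (simp_all add: pmf_run_tests[OF 1] del: One_nat_def)
qed

end

subsection \<open>Estimating an eigenvalue by tests at dyadic times\<close>

text \<open>Index \<open>2 * l\<close> probes the cosine of \<open>2 ^ l * e\<close> and index
  \<open>2 * l + 1\<close> its sine, through \<open>cos (u - pi / 2) = sin u\<close>.\<close>

definition ladder_test :: "nat \<Rightarrow> real \<times> real" where
  "ladder_test b = (2 ^ (b div 2), if even b then 0 else - pi / 2)"

text \<open>Position \<open>b * R + i\<close> holds repetition \<open>i\<close> of test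
  \<open>b\<close>.\<close>

definition ladder :: "nat \<Rightarrow> nat \<Rightarrow> (real \<times> real) list" where
  "ladder R L = map (\<lambda>i. ladder_test (i div R)) [0..<2 * Suc L * R]"

text \<open>The tolerance on frequencies is the constant \<open>1 / 8\<close> at every scale: the
  resolution comes from long times, not from accurate frequencies.\<close>

definition consistent :: "nat \<Rightarrow> nat \<Rightarrow> bool list \<Rightarrow> real \<Rightarrow> bool" where
  "consistent R L ds x \<longleftrightarrow> 0 \<le> x \<and> x \<le> pi \<and>
    (\<forall>b<2 * Suc L. \<bar>\<Sum>i<R. of_bool (ds ! (b * R + i)) - hadamard_prob x (ladder_test b)\<bar> \<le> R / 8)"

text \<open>Any consistent value will do, since two of them are close. If there is none, the value
  is arbitrary and the run is counted as a failure.\<close>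

definition estimate :: "nat \<Rightarrow> nat \<Rightarrow> bool list \<Rightarrow> real" where
  "estimate R L ds = (SOME x. consistent R L ds x)"

section \<open>Recovering an angle from its behaviour at dyadic scales\<close>

lemma abs_le_pi_third:
  assumes "\<bar>d\<bar> \<le> pi" "1 / 2 \<le> cos d"
  shows "\<bar>d\<bar> \<le> pi / 3"
proof (rule ccontr)
  assume "\<not> ?thesis"
  then have "cos \<bar>d\<bar> < cos (pi / 3)" using assms(1) by (intro cos_monotone_0_pi) auto
  then show False using assms(2) by (simp add: cos_60)
qed

text \<open>If \<open>2 ^ l * d\<close> is within \<open>pi / 3\<close>, its double is within
  \<open>2 * pi / 3\<close>, hence below \<open>pi\<close>, and the cosine at the next scale has no
  wrap-around ambiguity.\<close>

lemma abs_le_of_cos_ladder: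
  assumes "\<bar>d\<bar> \<le> pi" "\<And>l. l \<le> L \<Longrightarrow> 1 / 2 \<le> cos (2 ^ l * d)"
  shows "\<bar>d\<bar> \<le> pi / (3 * 2 ^ L)"
proof -
  have "l \<le> L \<Longrightarrow> \<bar>2 ^ l * d\<bar> \<le> pi / 3" for l
  proof (induction l)
    case 0
    then show ?case using abs_le_pi_third[OF assms(1)] assms(2)[of 0] by simp
  next
    case (Suc l)
    then have "\<bar>2 ^ l * d\<bar> \<le> pi / 3" by simp
    moreover have "\<bar>2 ^ Suc l * d\<bar> = 2 * \<bar>2 ^ l * d\<bar>" by (simp add: abs_mult)
    ultimately have "\<bar>2 ^ Suc l * d\<bar> \<le> pi" using pi_gt_zero by linarith
    then show ?case using assms(2)[OF Suc.prems] by (rule abs_le_pi_third)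
  qed
  from this[of L] show ?thesis by (simp add: abs_mult field_simps)
qed

text \<open>The hypotheses bound a chord of the unit circle, whose squared length is
  \<open>2 - 2 * cos (x - y)\<close>.\<close>

lemma cos_diff_ge:
  fixes x y :: real
  assumes "\<bar>cos x - cos y\<bar> \<le> 1 / 2" "\<bar>sin x - sin y\<bar> \<le> 1 / 2"
  shows "1 / 2 \<le> cos (x - y)"
proof -
  have "(cos x - cos y)\<^sup>2 \<le> 1 / 4" "(sin x - sin y)\<^sup>2 \<le> 1 / 4"
    using assms abs_le_square_iff[of _ "1 / 2 :: real"] by (simp_all add: power_divide)
  moreover have "(cos x - cos y)\<^sup>2 + (sin x - sin y)\<^sup>2 = 2 - 2 * cos (x - y)"
    by (simp add: cos_diff power2_diff sin_squared_eq)
  ultimately show ?thesis by linarith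
qed

text \<open>Both predictions are within \<open>1 / 8\<close> of the same frequency, so they differ
  by at most \<open>1 / 4\<close>, and the cosines and sines by at most \<open>1 / 2\<close> at
  every scale.\<close>

lemma consistent_unique:
  assumes x: "consistent R L ds x" and y: "consistent R L ds y" and R: "0 < R"
  shows "\<bar>x - y\<bar> \<le> pi / (3 * 2 ^ L)"
proof (rule abs_le_of_cos_ladder)
  show "\<bar>x - y\<bar> \<le> pi" using x y by (auto simp: consistent_def)
  have h: "\<bar>cos (2 ^ (b div 2) * x + snd (ladder_test b)) - cos (2 ^ (b div 2) * y + snd (ladder_test b))\<bar> \<le> 1 / 2"
    if "b < 2 * Suc L" for b
  proof -
    let ?s = "\<Sum>i<R. of_bool (ds ! (b * R + i)) :: real"
    have "\<bar>?s - R * hadamard_prob x (ladder_test b)\<bar> \<le> R / 8" "\<bar>?s - R * hadamard_prob y (ladder_test b)\<bar> \<le> R / 8"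
      using x y that by (auto simp: consistent_def sum_subtractf)
    then have "\<bar>R * hadamard_prob x (ladder_test b) - R * hadamard_prob y (ladder_test b)\<bar> \<le> R * (1 / 4)"
      by linarith
    then have "\<bar>hadamard_prob x (ladder_test b) - hadamard_prob y (ladder_test b)\<bar> \<le> 1 / 4"
      using R by (simp only: right_diff_distrib[symmetric] abs_mult abs_of_nat) simp
    moreover have "hadamard_prob z (ladder_test b) = (1 + cos (2 ^ (b div 2) * z + snd (ladder_test b))) / 2" for z
      by (simp add: hadamard_prob_def ladder_test_def)
    moreover have "(1 + u) / 2 - (1 + v) / 2 = (u - v) / 2" for u v :: real by (simp add: field_simps)
    ultimately show ?thesis by simp
  qed
  show "1 / 2 \<le> cos (2 ^ l * (x - y))" if "l \<le> L" for l
    using h[of "2 * l"] h[of "Suc (2 * l)"] that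
    by (simp only: right_diff_distrib, intro cos_diff_ge) (simp_all add: ladder_test_def cos_diff)
qed

lemma prob_block_deviation:
  fixes \<sigma> :: real
  assumes b: "b < 2 * Suc L" and \<sigma>: "\<bar>\<sigma>\<bar> = 1"
  shows "measure_pmf.prob (tests_pmf (ladder R L) e)
    {ds. R / 8 \<le> \<sigma> * (\<Sum>i<R. of_bool (ds ! (b * R + i)) - hadamard_prob e (ladder_test b))} \<le> exp (- (R / 256))"
proof -
  let ?n = "2 * Suc L * R" and ?B = "{b * R..<b * R + R}"
  let ?ps = "map (\<lambda>p. bernoulli_pmf (hadamard_prob e p)) (ladder R L)"
  define g where "g x = \<sigma> * (of_bool x - hadamard_prob e (ladder_test b))" for x
  \<comment> \<open>The tilt \<open>1 / 16\<close> acts on block \<open>b\<close> only. With mean 0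
    and second moment at most 1 the exponent is \<open>R / 256 - R / 128\<close>.\<close>
  define f where "f i x = (if i \<in> ?B then 1 / 16 * g x else 0)" for i x
  define v where "v i = (if i \<in> ?B then 1 / 256 else 0 :: real)" for i
  have len: "length ?ps = ?n" by (simp add: ladder_def)
  have "b * R + R = Suc b * R" by simp
  also have "\<dots> \<le> 2 * Suc L * R" using b by (intro mult_le_mono1) simp
  finally have sub: "?B \<subseteq> {..<?n}" by auto
  have g: "\<bar>g x\<bar> \<le> 1" for x
    using hadamard_prob_bounds[of e "ladder_test b"] \<sigma> by (cases x) (auto simp: g_def abs_mult)
  have sh: "sum h ?B = (\<Sum>i<R. h (b * R + i))" for h :: "nat \<Rightarrow> real"
    using sum.shift_bounds_nat_ivl[of h 0 "b * R" R] by (simp add: atLeast0LessThan add.commute)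
  have fi: "measure_pmf.expectation (?ps ! i) (\<lambda>x. exp (f i x)) \<le> exp (v i)" if "i < length ?ps" for i
  proof (cases "i \<in> ?B")
    case True
    then have "R > 0" by auto
    then have "i div R = b" using True by (intro div_nat_eqI) (auto simp: mult.commute)
    then have ps: "?ps ! i = bernoulli_pmf (hadamard_prob e (ladder_test b))"
      using that by (simp add: ladder_def)
    have "measure_pmf.expectation (?ps ! i) (\<lambda>x. exp (1 / 16 * g x)) \<le> exp (1 / 16 * 0 + (1 / 16)\<^sup>2 * 1)"
    proof (rule mgf_le[OF g])
      show "measure_pmf.expectation (?ps ! i) g \<le> 0"
        unfolding ps g_def using hadamard_prob_bounds[of e "ladder_test b"] by (simp add: algebra_simps)
      show "measure_pmf.expectation (?ps ! i) (\<lambda>x. (g x)\<^sup>2) \<le> 1"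
        by (rule measure_pmf.integral_le_const[OF integrable_pmf_bounded[where B = 1]])
          (use g in \<open>auto simp: abs_square_le_1\<close>)
    qed auto
    then show ?thesis using True by (simp add: f_def v_def power2_eq_square)
  next
    case False
    show ?thesis unfolding f_def v_def if_not_P[OF False] by simp
  qed
  have "measure_pmf.prob (tests_pmf (ladder R L) e)
      {ds. R / 8 \<le> \<sigma> * (\<Sum>i<R. of_bool (ds ! (b * R + i)) - hadamard_prob e (ladder_test b))}
    = measure_pmf.prob (seq_pmf ?ps) {ds. R / 128 \<le> (\<Sum>i<length ?ps. f i (ds ! i))}"
  proof -
    have "(\<Sum>i<length ?ps. f i (ds ! i)) = (1 / 16) * (\<sigma> * (\<Sum>i<R. of_bool (ds ! (b * R + i)) - hadamard_prob e (ladder_test b)))" for ds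
    proof -
      have "(\<Sum>i<length ?ps. f i (ds ! i)) = (\<Sum>i\<in>?B. 1 / 16 * g (ds ! i))"
        unfolding len by (rule sum.mono_neutral_cong_right) (use sub in \<open>auto simp: f_def\<close>)
      then show ?thesis by (simp only: sh g_def sum_distrib_left)
    qed
    then show ?thesis unfolding tests_pmf_def by (simp only:) simp
  qed
  also have "\<dots> \<le> exp ((\<Sum>i<length ?ps. v i) - R / 128)"
  proof (rule chernoff_seq_pmf[OF _ fi])
    show "\<bar>f i x\<bar> \<le> 1" for i x using g[of x] by (auto simp: f_def)
  qed
  also have "(\<Sum>i<length ?ps. v i) = (\<Sum>i\<in>?B. 1 / 256)"
    unfolding len by (rule sum.mono_neutral_cong_right) (use sub in \<open>auto simp: v_def\<close>)
  finally show ?thesis by simp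
qed

text \<open>Union bound over \<open>2 * Suc L\<close> blocks with two tails each.\<close>

lemma prob_not_consistent:
  assumes "0 \<le> e" "e \<le> pi"
  shows "measure_pmf.prob (tests_pmf (ladder R L) e) {ds. \<not> consistent R L ds e} \<le> 4 * Suc L * exp (- (R / 256))"
proof -
  let ?P = "tests_pmf (ladder R L) e"
  let ?D = "\<lambda>b \<sigma>. {ds. R / 8 \<le> \<sigma> * (\<Sum>i<R. of_bool (ds ! (b * R + i)) - hadamard_prob e (ladder_test b))}"
  let ?I = "{..<2 * Suc L}"
  have "measure_pmf.prob ?P {ds. \<not> consistent R L ds e} \<le> measure_pmf.prob ?P (\<Union>b\<in>?I. ?D b 1 \<union> ?D b (- 1))"
    by (intro measure_pmf.finite_measure_mono)
      (use assms in \<open>auto simp: consistent_def abs_le_iff not_le intro: less_imp_le\<close>)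
  also have "\<dots> \<le> (\<Sum>b\<in>?I. measure_pmf.prob ?P (?D b 1 \<union> ?D b (- 1)))"
    by (rule measure_pmf.finite_measure_subadditive_finite) auto
  also have "\<dots> \<le> (\<Sum>b\<in>?I. exp (- (R / 256)) + exp (- (R / 256)))"
  proof (rule sum_mono)
    fix b assume "b \<in> ?I"
    then have b: "b < 2 * Suc L" by simp
    have "measure_pmf.prob ?P (?D b 1 \<union> ?D b (- 1)) \<le> measure_pmf.prob ?P (?D b 1) + measure_pmf.prob ?P (?D b (- 1))"
      by (rule measure_Un_le) auto
    also have "\<dots> \<le> exp (- (R / 256)) + exp (- (R / 256))"
      by (intro add_mono prob_block_deviation[OF b]) auto
    finally show "measure_pmf.prob ?P (?D b 1 \<union> ?D b (- 1)) \<le> exp (- (R / 256)) + exp (- (R / 256))" .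
  qed
  finally show ?thesis by (simp add: algebra_simps)
qed

lemma estimate_close:
  assumes "consistent R L ds e" "0 < R"
  shows "\<bar>estimate R L ds - e\<bar> \<le> pi / (3 * 2 ^ L)"
  using consistent_unique[OF _ assms] someI[of "consistent R L ds", OF assms(1)] unfolding estimate_def by blast

subsection \<open>Estimating the smallest eigenvalue from a mixture\<close>

lemma expectation_of_bool: "measure_pmf.expectation p (\<lambda>x. of_bool (A x)) = measure_pmf.prob p {x. A x}"
proof -
  have "(\<lambda>x. of_bool (A x) :: real) = indicator {x. A x}" by (auto simp: indicator_def)
  then show ?thesis by simp
qed

text \<open>An indicator equals its square, so the second moment is \<open>P\<close> too; tilt
  \<open>1 / 4\<close> makes the exponent linear in \<open>M * P\<close>.\<close>

lemma prob_count_le: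
  assumes "P = measure_pmf.prob p {x. A x}"
  shows "measure_pmf.prob (seq_pmf (replicate M p)) {xs. (\<Sum>i<M. of_bool (A (xs ! i))) \<le> M * P / 2}
    \<le> exp (- (M * P / 16))"
proof -
  have "measure_pmf.prob (seq_pmf (replicate M p)) {xs. - (M * P / 2) \<le> (\<Sum>i<M. - of_bool (A (xs ! i)))}
      \<le> exp (M * (1 / 4 * (- P) + (1 / 4)\<^sup>2 * P) - 1 / 4 * (- (M * P / 2)))"
  proof (rule bernstein_replicate)
    have "(\<lambda>x. (- of_bool (A x) :: real)\<^sup>2) = (\<lambda>x. of_bool (A x))" by auto
    then show "measure_pmf.expectation p (\<lambda>x. (- of_bool (A x) :: real)\<^sup>2) \<le> P"
      by (simp only: expectation_of_bool assms)
  qed (auto simp: expectation_of_bool assms)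
  also have "M * (1 / 4 * (- P) + (1 / 4)\<^sup>2 * P) - 1 / 4 * (- (M * P / 2)) = - (M * P / 16)"
    by (simp add: field_simps power2_eq_square)
  finally show ?thesis by (simp add: sum_negf)
qed

lemma prob_count_ge:
  assumes "measure_pmf.prob p {x. A x} \<le> v"
  shows "measure_pmf.prob (seq_pmf (replicate M p)) {xs. 4 * real M * v \<le> (\<Sum>i<M. of_bool (A (xs ! i)))}
    \<le> exp (- (2 * real M * v))"
proof -
  have "measure_pmf.prob (seq_pmf (replicate M p)) {xs. 4 * real M * v \<le> (\<Sum>i<M. of_bool (A (xs ! i)))}
      \<le> exp (M * (1 * v + 1\<^sup>2 * v) - 1 * (4 * real M * v))"
  proof (rule bernstein_replicate)
    have "(\<lambda>x. (of_bool (A x) :: real)\<^sup>2) = (\<lambda>x. of_bool (A x))" by auto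
    then show "measure_pmf.expectation p (\<lambda>x. (of_bool (A x) :: real)\<^sup>2) \<le> v"
      by (simp only: expectation_of_bool assms)
  qed (use assms in \<open>auto simp: expectation_of_bool\<close>)
  also have "M * (1 * v + 1\<^sup>2 * v) - 1 * (4 * real M * v) = - (2 * real M * v)"
    by (simp add: algebra_simps)
  finally show ?thesis .
qed

text \<open>Compares the frequency of \<open>B\<close> among the runs kept by \<open>A\<close> with
  \<open>p0\<close>, without conditioning. The summand vanishes outside \<open>A\<close>, so its
  second moment is at most \<open>P\<close>. The bias uses up half of the threshold, and the tilt is
  \<open>s / 2\<close>.\<close>

lemma prob_conditional_deviation:
  fixes p0 s :: real
  assumes P: "P = measure_pmf.prob p {x. A x}" and p0: "0 \<le> p0" "p0 \<le> 1" and s: "0 \<le> s" "s \<le> 1"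
    and AB: "\<bar>measure_pmf.prob p {x. A x \<and> B x} - p0 * P\<bar> \<le> s * P"
  shows "measure_pmf.prob (seq_pmf (replicate M p))
      {xs. 2 * s * M * P \<le> \<bar>\<Sum>i<M. of_bool (A (xs ! i)) * (of_bool (B (xs ! i)) - p0)\<bar>}
    \<le> 2 * exp (- (s\<^sup>2 * M * P / 4))"
proof -
  let ?f = "\<lambda>x. of_bool (A x) * (of_bool (B x) - p0)"
  let ?S = "\<lambda>\<sigma>. {xs. 2 * s * M * P \<le> (\<Sum>i<M. \<sigma> * ?f (xs ! i))}"
  have f: "\<bar>?f x\<bar> \<le> 1" for x using p0 by auto
  have Ef: "measure_pmf.expectation p ?f = measure_pmf.prob p {x. A x \<and> B x} - p0 * P"
  proof -
    have "?f = (\<lambda>x. of_bool (A x \<and> B x) - p0 * of_bool (A x))" by auto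
    moreover have "integrable (measure_pmf p) (\<lambda>x. of_bool (C x) :: real)" for C
      by (rule integrable_pmf_bounded[where B = 1]) auto
    ultimately show ?thesis by (simp add: expectation_of_bool P del: of_bool_conj)
  qed
  have 1: "measure_pmf.prob (seq_pmf (replicate M p)) (?S \<sigma>) \<le> exp (- (s\<^sup>2 * M * P / 4))"
    if \<sigma>: "\<bar>\<sigma>\<bar> = 1" for \<sigma> :: real
  proof -
    have "measure_pmf.prob (seq_pmf (replicate M p)) (?S \<sigma>)
        \<le> exp (M * (s / 2 * (s * P) + (s / 2)\<^sup>2 * P) - s / 2 * (2 * s * M * P))"
    proof (rule bernstein_replicate)
      show "\<bar>\<sigma> * ?f x\<bar> \<le> 1" for x using f[of x] \<sigma> by (simp only: abs_mult)
      have "\<sigma> * measure_pmf.expectation p ?f \<le> \<bar>\<sigma> * measure_pmf.expectation p ?f\<bar>" by simp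
      also have "\<dots> \<le> s * P" using AB \<sigma> by (simp add: abs_mult Ef)
      finally show "measure_pmf.expectation p (\<lambda>x. \<sigma> * ?f x) \<le> s * P" by simp
      have "measure_pmf.expectation p (\<lambda>x. (\<sigma> * ?f x)\<^sup>2) \<le> measure_pmf.expectation p (\<lambda>x. of_bool (A x))"
      proof (rule integral_mono)
        have sq: "(\<sigma> * ?f x)\<^sup>2 \<le> 1" for x
          using f[of x] \<sigma> abs_square_le_1[of "\<sigma> * ?f x"] by (simp only: abs_mult)
        then show "integrable (measure_pmf p) (\<lambda>x. (\<sigma> * ?f x)\<^sup>2)"
          by (intro integrable_pmf_bounded[where B = 1]) simp
        show "integrable (measure_pmf p) (\<lambda>x. of_bool (A x) :: real)"
          by (rule integrable_pmf_bounded[where B = 1]) auto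
        show "(\<sigma> * ?f x)\<^sup>2 \<le> of_bool (A x)" for x
          using sq[of x] by (cases "A x") auto
      qed
      then show "measure_pmf.expectation p (\<lambda>x. (\<sigma> * ?f x)\<^sup>2) \<le> P"
        by (simp add: expectation_of_bool P)
    qed (use s in auto)
    also have "M * (s / 2 * (s * P) + (s / 2)\<^sup>2 * P) - s / 2 * (2 * s * M * P) = - (s\<^sup>2 * M * P / 4)"
      by (simp add: field_simps power2_eq_square)
    finally show ?thesis .
  qed
  have "measure_pmf.prob (seq_pmf (replicate M p)) {xs. 2 * s * M * P \<le> \<bar>\<Sum>i<M. ?f (xs ! i)\<bar>}
      \<le> measure_pmf.prob (seq_pmf (replicate M p)) (?S 1 \<union> ?S (- 1))"
    by (intro measure_pmf.finite_measure_mono) (auto simp: sum_negf abs_if split: if_splits)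
  also have "\<dots> \<le> measure_pmf.prob (seq_pmf (replicate M p)) (?S 1) + measure_pmf.prob (seq_pmf (replicate M p)) (?S (- 1))"
    by (rule measure_Un_le) auto
  also have "\<dots> \<le> exp (- (s\<^sup>2 * M * P / 4)) + exp (- (s\<^sup>2 * M * P / 4))"
    by (intro add_mono 1) auto
  finally show ?thesis by simp
qed

section \<open>The coarse and the refined estimator\<close>

definition quantile :: "real \<Rightarrow> real \<Rightarrow> nat \<Rightarrow> (nat \<Rightarrow> real) \<Rightarrow> real" where
  "quantile \<eta> \<rho> M y = (SOME x. (\<Sum>i<M. of_bool (y i \<le> x - \<rho>)) < \<eta> * M / 4 \<and>
     \<eta> * M / 4 \<le> (\<Sum>i<M. of_bool (y i \<le> x + \<rho>)))"

text \<open>The counts cross the threshold within \<open>\<rho>\<close> of \<open>x\<close> and also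
  within \<open>\<rho>\<close> of the chosen value. As counts are monotone, the two intervals
  overlap.\<close>

lemma quantile_close:
  assumes "(\<Sum>i<M. of_bool (y i \<le> x - \<rho>)) < \<eta> * M / 4" "\<eta> * M / 4 \<le> (\<Sum>i<M. of_bool (y i \<le> x + \<rho>))"
  shows "\<bar>quantile \<eta> \<rho> M y - x\<bar> \<le> 2 * \<rho>"
proof -
  define z where "z = quantile \<eta> \<rho> M y"
  have z: "(\<Sum>i<M. of_bool (y i \<le> z - \<rho>)) < \<eta> * M / 4" "\<eta> * M / 4 \<le> (\<Sum>i<M. of_bool (y i \<le> z + \<rho>))"
    using someI[of "\<lambda>x. (\<Sum>i<M. of_bool (y i \<le> x - \<rho>)) < \<eta> * M / 4 \<and>
       \<eta> * M / 4 \<le> (\<Sum>i<M. of_bool (y i \<le> x + \<rho>))" x] assms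
    unfolding z_def quantile_def by blast+
  have mono: "(\<Sum>i<M. of_bool (y i \<le> a) :: real) \<le> (\<Sum>i<M. of_bool (y i \<le> b))" if "a \<le> b" for a b
    using that by (intro sum_mono) auto
  have "\<not> z + \<rho> \<le> x - \<rho>" using mono[of "z + \<rho>" "x - \<rho>"] z assms by linarith
  moreover have "\<not> x + \<rho> \<le> z - \<rho>" using mono[of "x + \<rho>" "z - \<rho>"] z assms by linarith
  ultimately show ?thesis by (simp add: z_def[symmetric])
qed

text \<open>Mean value theorem, with cosine at least \<open>1 / 2\<close> on \<open>[-1, 1]\<close>
  because \<open>1 \<le> pi / 3\<close>.\<close>

lemma abs_diff_le_sin:
  fixes a b :: real
  assumes "\<bar>a\<bar> \<le> 1" "\<bar>b\<bar> \<le> 1"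
  shows "\<bar>a - b\<bar> \<le> 2 * \<bar>sin a - sin b\<bar>"
proof -
  have *: "y - x \<le> 2 * \<bar>sin y - sin x\<bar>" if xy: "x < y" "\<bar>x\<bar> \<le> 1" "\<bar>y\<bar> \<le> 1" for x y :: real
  proof -
    obtain z where z: "x < z" "z < y" "sin y - sin x = (y - x) * cos z"
      using MVT2[OF xy(1), of sin cos] by (auto intro: derivative_intros)
    have "cos (pi / 3) \<le> cos \<bar>z\<bar>"
      using z xy pi_gt3 by (intro cos_monotone_0_pi_le) auto
    then have "1 / 2 \<le> cos z" by (simp add: cos_60)
    then have "(y - x) * (1 / 2) \<le> (y - x) * cos z" using xy by (intro mult_left_mono) auto
    then show ?thesis using z by simp
  qed
  show ?thesis using *[of a b] *[of b a] assms by (cases a b rule: linorder_cases) (auto simp: abs_minus_commute)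
qed

text \<open>The success probability of a Hadamard test at time \<open>1 / W\<close> whose phase puts
  \<open>x0\<close> at the zero of the sine, where the response is steepest.\<close>

definition sine_prob :: "real \<Rightarrow> real \<Rightarrow> real \<Rightarrow> real" where
  "sine_prob W x0 x = (1 + sin ((x - x0) / W)) / 2"

text \<open>\<open>A\<close> marks the kept runs and \<open>B\<close> is the outcome of the extra
  test. The fit is stated with counts instead of frequencies to avoid a division.\<close>

definition refine :: "real \<Rightarrow> real \<Rightarrow> real \<Rightarrow> nat \<Rightarrow> (nat \<Rightarrow> bool) \<Rightarrow> (nat \<Rightarrow> bool) \<Rightarrow> real" where
  "refine W s x0 M A B = (SOME x. \<bar>x - x0\<bar> \<le> W / 4 \<and>
     \<bar>\<Sum>i<M. of_bool (A i) * (of_bool (B i) - sine_prob W x0 x)\<bar> \<le> 4 * s * (\<Sum>i<M. of_bool (A i)))"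

lemma refine_close:
  assumes W: "0 < W" and x: "\<bar>x - x0\<bar> \<le> W / 4"
    and dev: "\<bar>\<Sum>i<M. of_bool (A i) * (of_bool (B i) - sine_prob W x0 x)\<bar> \<le> 4 * s * (\<Sum>i<M. of_bool (A i))"
    and pos: "(0::real) < (\<Sum>i<M. of_bool (A i))"
  shows "\<bar>refine W s x0 M A B - x\<bar> \<le> 32 * s * W"
proof -
  define z where "z = refine W s x0 M A B"
  define n :: real where "n = (\<Sum>i<M. of_bool (A i))"
  define m :: real where "m = (\<Sum>i<M. of_bool (A i) * of_bool (B i))"
  let ?p = "sine_prob W x0"
  have "\<bar>z - x0\<bar> \<le> W / 4 \<and>
     \<bar>\<Sum>i<M. of_bool (A i) * (of_bool (B i) - ?p z)\<bar> \<le> 4 * s * (\<Sum>i<M. of_bool (A i))"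
    unfolding z_def refine_def by (rule someI[of _ x]) (use x dev in blast)
  moreover have sm: "(\<Sum>i<M. of_bool (A i) * (of_bool (B i) - c)) = m - n * c" for c
    by (simp add: right_diff_distrib sum_subtractf sum_distrib_right m_def n_def)
  ultimately have z: "\<bar>z - x0\<bar> \<le> W / 4" "\<bar>m - n * ?p z\<bar> \<le> 4 * s * n" and d: "\<bar>m - n * ?p x\<bar> \<le> 4 * s * n"
    using dev by (auto simp only: n_def)
  \<comment> \<open>The tolerance \<open>4 * s\<close> doubles three times: by the triangle
    inequality, by the factor \<open>1 / 2\<close> in \<open>sine_prob\<close>, and by inverting the
    sine.\<close>
  have "\<bar>n * ?p z - n * ?p x\<bar> \<le> 4 * s * n + 4 * s * n" using z(2) d by linarith
  also have "\<dots> = n * (8 * s)" by simp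
  finally have "\<bar>n * ?p z - n * ?p x\<bar> \<le> n * (8 * s)" .
  then have "\<bar>?p z - ?p x\<bar> \<le> 8 * s"
    using pos by (simp only: n_def[symmetric] right_diff_distrib[symmetric] abs_mult) simp
  moreover have "?p z - ?p x = (sin ((z - x0) / W) - sin ((x - x0) / W)) / 2"
    by (simp add: sine_prob_def field_simps)
  ultimately have "\<bar>sin ((z - x0) / W) - sin ((x - x0) / W)\<bar> \<le> 16 * s" by simp
  moreover have "\<bar>(y - x0) / W\<bar> \<le> 1" if "\<bar>y - x0\<bar> \<le> W / 4" for y
    using that W by (simp add: abs_divide)
  ultimately have "\<bar>(z - x0) / W - (x - x0) / W\<bar> \<le> 32 * s"
    using abs_diff_le_sin[of "(z - x0) / W" "(x - x0) / W"] z(1) x by fastforce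
  moreover have "(z - x0) / W - (x - x0) / W = (z - x) / W" by (simp add: diff_divide_distrib)
  ultimately show ?thesis using W by (simp add: z_def[symmetric] abs_divide field_simps)
qed

text \<open>One stage in the abstract: \<open>Q\<close> is the law of a run, \<open>Qs j\<close> its
  law on eigenstate \<open>j\<close>, and \<open>q\<close> bounds the probability of a bad estimate.
  Both stages are instances, since a leading extra test leaves the law of the ladder outcomes
  unchanged.\<close>

locale overlap_mixture =
  fixes N :: nat and w :: "nat \<Rightarrow> real" and e :: "nat \<Rightarrow> real" and Q :: "'a pmf"
    and Qs :: "nat \<Rightarrow> 'a pmf" and est :: "'a \<Rightarrow> real" and \<eta> \<rho> q :: real
  assumes mix: "measure_pmf.prob Q S = (\<Sum>j<N. w j * measure_pmf.prob (Qs j) S)"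
    and w_nonneg: "0 \<le> w j" and w_sum: "(\<Sum>j<N. w j) = 1" and N: "0 < N"
    and \<eta>: "0 < \<eta>" "\<eta> \<le> w 0" and e0: "j < N \<Longrightarrow> e 0 \<le> e j"
    and est: "j < N \<Longrightarrow> measure_pmf.prob (Qs j) {x. \<rho> \<le> \<bar>est x - e j\<bar>} \<le> q"
    and q: "q \<le> \<eta> / 16" and \<rho>: "0 < \<rho>"
begin

lemma q_nonneg: "0 \<le> q"
  using est[OF N] measure_nonneg order_trans by blast

lemma w0_le: "w 0 \<le> 1"
  using member_le_sum[of 0 "{..<N}" w] w_nonneg w_sum N by auto

text \<open>The ground state alone suffices: it has weight at least \<open>\<eta>\<close>, and its
  estimate is good with probability at least \<open>1 - q\<close>, which exceeds
  \<open>1 / 2\<close>.\<close>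

lemma prob_ge_half:
  assumes "{x. \<bar>est x - e 0\<bar> < \<rho>} \<subseteq> S"
  shows "\<eta> / 2 \<le> measure_pmf.prob Q S"
proof -
  have "measure_pmf.prob (Qs 0) (UNIV - {x. \<rho> \<le> \<bar>est x - e 0\<bar>}) = 1 - measure_pmf.prob (Qs 0) {x. \<rho> \<le> \<bar>est x - e 0\<bar>}"
    using measure_pmf.prob_compl[of "{x. \<rho> \<le> \<bar>est x - e 0\<bar>}" "Qs 0"] by simp
  moreover have "measure_pmf.prob (Qs 0) (UNIV - {x. \<rho> \<le> \<bar>est x - e 0\<bar>}) \<le> measure_pmf.prob (Qs 0) S"
    by (rule measure_pmf.finite_measure_mono) (use assms in \<open>auto simp: subset_iff not_less[symmetric]\<close>)
  ultimately have "1 / 2 \<le> measure_pmf.prob (Qs 0) S"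
    using est[OF N] q \<eta> w0_le by linarith
  then have "\<eta> * (1 / 2) \<le> w 0 * measure_pmf.prob (Qs 0) S"
    using \<eta> by (intro mult_mono) auto
  also have "\<dots> \<le> measure_pmf.prob Q S"
    unfolding mix by (rule member_le_sum[of 0]) (use N w_nonneg in auto)
  finally show ?thesis by simp
qed

text \<open>No eigenvalue lies below \<open>e 0\<close>, so an estimate below
  \<open>e 0 - \<rho>\<close> is a failure for every \<open>j\<close>. The threshold
  \<open>\<eta> * M / 4\<close> is at least four times the expected number of these and at most half
  the expected number of estimates up to \<open>e 0 + \<rho>\<close>.\<close>

lemma prob_quantile:
  "measure_pmf.prob (seq_pmf (replicate M Q)) {xs. \<not> \<bar>quantile \<eta> \<rho> M (\<lambda>i. est (xs ! i)) - e 0\<bar> \<le> 2 * \<rho>}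
    \<le> 2 * exp (- (M * \<eta> / 32))"
proof -
  define P where "P = measure_pmf.prob Q {x. est x \<le> e 0 + \<rho>}"
  have P: "\<eta> / 2 \<le> P" unfolding P_def by (rule prob_ge_half) auto
  have "measure_pmf.prob Q {x. est x \<le> e 0 - \<rho>} \<le> (\<Sum>j<N. w j * q)"
    unfolding mix
  proof (intro sum_mono mult_left_mono w_nonneg)
    fix j assume "j \<in> {..<N}"
    then have j: "j < N" by simp
    have "measure_pmf.prob (Qs j) {x. est x \<le> e 0 - \<rho>} \<le> measure_pmf.prob (Qs j) {x. \<rho> \<le> \<bar>est x - e j\<bar>}"
      by (rule measure_pmf.finite_measure_mono) (use e0[OF j] in auto)
    then show "measure_pmf.prob (Qs j) {x. est x \<le> e 0 - \<rho>} \<le> q" using est[OF j] by simp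
  qed
  also have "\<dots> = q" by (simp add: sum_distrib_right[symmetric] w_sum)
  finally have low: "measure_pmf.prob Q {x. est x \<le> e 0 - \<rho>} \<le> \<eta> / 16" using q by simp
  let ?L = "{xs. 4 * real M * (\<eta> / 16) \<le> (\<Sum>i<M. of_bool (est (xs ! i) \<le> e 0 - \<rho>))}"
  let ?H = "{xs. (\<Sum>i<M. of_bool (est (xs ! i) \<le> e 0 + \<rho>)) \<le> M * P / 2}"
  have MP: "M * \<eta> / 4 \<le> M * P / 2" using mult_left_mono[OF P, of "real M"] by (simp add: field_simps)
  have "measure_pmf.prob (seq_pmf (replicate M Q)) {xs. \<not> \<bar>quantile \<eta> \<rho> M (\<lambda>i. est (xs ! i)) - e 0\<bar> \<le> 2 * \<rho>}
      \<le> measure_pmf.prob (seq_pmf (replicate M Q)) (?L \<union> ?H)"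
  proof (intro measure_pmf.finite_measure_mono subsetI)
    fix xs assume "xs \<in> {xs. \<not> \<bar>quantile \<eta> \<rho> M (\<lambda>i. est (xs ! i)) - e 0\<bar> \<le> 2 * \<rho>}"
    then have "\<eta> * M / 4 \<le> (\<Sum>i<M. of_bool (est (xs ! i) \<le> e 0 - \<rho>))
        \<or> (\<Sum>i<M. of_bool (est (xs ! i) \<le> e 0 + \<rho>)) < \<eta> * M / 4"
      using quantile_close[where y = "\<lambda>i. est (xs ! i)" and M = M and x = "e 0" and \<rho> = \<rho> and \<eta> = \<eta>] by force
    moreover have "4 * real M * (\<eta> / 16) = \<eta> * M / 4" "M * \<eta> / 4 = \<eta> * M / 4" by simp_all
    ultimately show "xs \<in> ?L \<union> ?H" using MP by (simp only: Un_iff mem_Collect_eq) linarith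
  qed simp
  also have "\<dots> \<le> measure_pmf.prob (seq_pmf (replicate M Q)) ?L + measure_pmf.prob (seq_pmf (replicate M Q)) ?H"
    by (rule measure_Un_le) auto
  also have "\<dots> \<le> exp (- (2 * real M * (\<eta> / 16))) + exp (- (M * P / 16))"
    by (intro add_mono prob_count_ge[OF low] prob_count_le P_def)
  also have "\<dots> \<le> exp (- (M * \<eta> / 32)) + exp (- (M * \<eta> / 32))"
    using MP \<eta> by (intro add_mono) auto
  finally show ?thesis by simp
qed

text \<open>The gap keeps excited states out: passing \<open>A\<close> puts the estimate at or below
  \<open>e 0 + 3 * W / 4\<close>, an error of at least \<open>W / 4\<close> for them. They
  contribute at most \<open>q \<le> s * P\<close>, while \<open>ground\<close> says that the ground
  state responds with exactly the predicted frequency.\<close>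

lemma prob_refine:
  fixes W s x0 :: real and B :: "'a \<Rightarrow> bool"
  defines "A \<equiv> \<lambda>x. est x \<le> x0 + W / 2"
  assumes \<rho>W: "\<rho> = W / 8" and gap: "\<And>j. 1 \<le> j \<Longrightarrow> j < N \<Longrightarrow> e 0 + W \<le> e j"
    and x0: "\<bar>x0 - e 0\<bar> \<le> W / 4" and s: "0 < s" "s \<le> 1" and qs: "q \<le> s * \<eta> / 2"
    and ground: "measure_pmf.prob (Qs 0) {x. A x \<and> B x} = sine_prob W x0 (e 0) * measure_pmf.prob (Qs 0) {x. A x}"
  shows "measure_pmf.prob (seq_pmf (replicate M Q))
      {xs. \<not> \<bar>refine W s x0 M (\<lambda>i. A (xs ! i)) (\<lambda>i. B (xs ! i)) - e 0\<bar> \<le> 32 * s * W}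
    \<le> exp (- (M * \<eta> / 32)) + 2 * exp (- (s\<^sup>2 * M * \<eta> / 8))"
proof -
  define P where "P = measure_pmf.prob Q {x. A x}"
  define p0 where "p0 = sine_prob W x0 (e 0)"
  have W: "0 < W" using \<rho> \<rho>W by simp
  have p0: "0 \<le> p0" "p0 \<le> 1"
    using half_one_plus_bounds[OF sin_ge_minus_one sin_le_one]
    unfolding p0_def sine_prob_def by blast+
  \<comment> \<open>Good estimates of the ground state pass, as
    \<open>W / 4 + W / 8 \<le> W / 2\<close>.\<close>
  have P: "\<eta> / 2 \<le> P"
    unfolding P_def by (rule prob_ge_half) (use x0 \<rho>W in \<open>auto simp: A_def\<close>)
  have exc: "measure_pmf.prob (Qs j) {x. A x} \<le> q" if "1 \<le> j" "j < N" for j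
  proof -
    have "measure_pmf.prob (Qs j) {x. A x} \<le> measure_pmf.prob (Qs j) {x. \<rho> \<le> \<bar>est x - e j\<bar>}"
      by (rule measure_pmf.finite_measure_mono) (use gap[OF that] x0 \<rho>W W in \<open>auto simp: A_def\<close>)
    then show ?thesis using est[OF that(2)] by simp
  qed
  have "\<bar>measure_pmf.prob Q {x. A x \<and> B x} - p0 * P\<bar>
      = \<bar>\<Sum>j<N. w j * (measure_pmf.prob (Qs j) {x. A x \<and> B x} - p0 * measure_pmf.prob (Qs j) {x. A x})\<bar>"
    unfolding P_def mix by (simp add: sum_distrib_left sum_subtractf algebra_simps)
  also have "\<dots> \<le> (\<Sum>j<N. \<bar>w j * (measure_pmf.prob (Qs j) {x. A x \<and> B x} - p0 * measure_pmf.prob (Qs j) {x. A x})\<bar>)"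
    by (rule sum_abs)
  also have "\<dots> \<le> (\<Sum>j<N. w j * q)"
    unfolding abs_mult
  proof (intro sum_mono mult_mono)
    fix j assume "j \<in> {..<N}"
    then have j: "j < N" by simp
    show "\<bar>measure_pmf.prob (Qs j) {x. A x \<and> B x} - p0 * measure_pmf.prob (Qs j) {x. A x}\<bar> \<le> q"
    proof (cases "j = 0")
      case True
      then show ?thesis using ground q_nonneg by (simp add: p0_def)
    next
      case False
      have a: "measure_pmf.prob (Qs j) {x. A x \<and> B x} \<le> measure_pmf.prob (Qs j) {x. A x}"
        by (rule measure_pmf.finite_measure_mono) auto
      have b: "p0 * measure_pmf.prob (Qs j) {x. A x} \<le> measure_pmf.prob (Qs j) {x. A x}"
        by (rule mult_left_le_one_le) (use p0 in auto)
      have c: "0 \<le> p0 * measure_pmf.prob (Qs j) {x. A x}" using p0 by simp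
      have "0 \<le> measure_pmf.prob (Qs j) {x. A x \<and> B x}" by simp
      then show ?thesis using a b c exc[OF _ j] False by linarith
    qed
  qed (use w_nonneg in auto)
  also have "\<dots> = q" by (simp add: sum_distrib_right[symmetric] w_sum)
  also have "q \<le> s * (\<eta> / 2)" using qs by simp
  also have "\<dots> \<le> s * P" using P s by (intro mult_left_mono) auto
  finally have dev: "\<bar>measure_pmf.prob Q {x. A x \<and> B x} - p0 * P\<bar> \<le> s * P" .
  let ?C = "{xs. (\<Sum>i<M. of_bool (A (xs ! i))) \<le> M * P / 2}"
  let ?D = "{xs. 2 * s * M * P \<le> \<bar>\<Sum>i<M. of_bool (A (xs ! i)) * (of_bool (B (xs ! i)) - p0)\<bar>}"
  have "measure_pmf.prob (seq_pmf (replicate M Q))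
      {xs. \<not> \<bar>refine W s x0 M (\<lambda>i. A (xs ! i)) (\<lambda>i. B (xs ! i)) - e 0\<bar> \<le> 32 * s * W}
    \<le> measure_pmf.prob (seq_pmf (replicate M Q)) (?C \<union> ?D)"
  proof (intro measure_pmf.finite_measure_mono subsetI)
    fix xs
    assume *: "xs \<in> {xs. \<not> \<bar>refine W s x0 M (\<lambda>i. A (xs ! i)) (\<lambda>i. B (xs ! i)) - e 0\<bar> \<le> 32 * s * W}"
    show "xs \<in> ?C \<union> ?D"
    proof (rule ccontr)
      assume "xs \<notin> ?C \<union> ?D"
      then have c: "M * P / 2 < (\<Sum>i<M. of_bool (A (xs ! i)))"
        and d: "\<bar>\<Sum>i<M. of_bool (A (xs ! i)) * (of_bool (B (xs ! i)) - p0)\<bar> < 2 * s * M * P" by auto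
      have "0 \<le> M * P / 2" using P \<eta> by simp
      then have pos: "(0::real) < (\<Sum>i<M. of_bool (A (xs ! i)))" using c by linarith
      \<comment> \<open>A bound relative to the unknown \<open>P\<close> becomes one relative to the
        observed count, which \<open>refine\<close> can check.\<close>
      have "2 * s * M * P = 4 * s * (M * P / 2)" by simp
      also have "\<dots> \<le> 4 * s * (\<Sum>i<M. of_bool (A (xs ! i)))"
        using c s by (intro mult_left_mono) auto
      finally have "\<bar>\<Sum>i<M. of_bool (A (xs ! i)) * (of_bool (B (xs ! i)) - p0)\<bar> \<le> 4 * s * (\<Sum>i<M. of_bool (A (xs ! i)))"
        using d by linarith
      moreover have "\<bar>e 0 - x0\<bar> \<le> W / 4" using x0 by linarith
      ultimately have "\<bar>refine W s x0 M (\<lambda>i. A (xs ! i)) (\<lambda>i. B (xs ! i)) - e 0\<bar> \<le> 32 * s * W"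
        unfolding p0_def by (intro refine_close[OF W _ _ pos])
      then show False using * by simp
    qed
  qed simp
  also have "\<dots> \<le> measure_pmf.prob (seq_pmf (replicate M Q)) ?C + measure_pmf.prob (seq_pmf (replicate M Q)) ?D"
    by (rule measure_Un_le) auto
  also have "\<dots> \<le> exp (- (M * P / 16)) + 2 * exp (- (s\<^sup>2 * M * P / 4))"
    using s by (intro add_mono prob_count_le prob_conditional_deviation P_def p0 dev) auto
  also have "\<dots> \<le> exp (- (M * \<eta> / 32)) + 2 * exp (- (s\<^sup>2 * M * \<eta> / 8))"
    using mult_left_mono[OF P, of "real M"] mult_left_mono[OF P, of "s\<^sup>2 * real M"] by (intro add_mono) (auto simp: field_simps)
  finally show ?thesis .
qed

end

subsection \<open>The two-stage algorithm\<close>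

text \<open>Continuation style: an \<open>algorithm\<close> is a decision tree, so the collected
  results are passed to the tree \<open>k\<close> that follows.\<close>

primrec repeat_query :: "nat \<Rightarrow> circuit \<Rightarrow> (bool list list \<Rightarrow> algorithm) \<Rightarrow> algorithm" where
  "repeat_query 0 c k = k []"
| "repeat_query (Suc m) c k = Query c (\<lambda>bs. repeat_query m c (\<lambda>bss. k (bs # bss)))"

definition repeat_tests :: "nat \<Rightarrow> (real \<times> real) list \<Rightarrow> (bool list list \<Rightarrow> algorithm) \<Rightarrow> algorithm" where
  "repeat_tests m ps k = repeat_query m (test_circuit ps) (\<lambda>bss. k (map (decode False) bss))"

lemma run_repeat_query:
  "run_algorithm n H \<psi> (repeat_query m c k) =
    bind_pmf (seq_pmf (replicate m (run_circuit n H \<psi> c)))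
      (\<lambda>bss. map_pmf (\<lambda>(cs, x). (replicate m c @ cs, x)) (run_algorithm n H \<psi> (k bss)))"
proof (induction m arbitrary: k)
  case 0
  then show ?case by (simp add: bind_return_pmf case_prod_beta)
next
  case (Suc m)
  show ?case
    by (simp add: Suc.IH map_bind_pmf bind_assoc_pmf bind_map_pmf map_pmf_comp case_prod_beta)
qed

lemma map_seq_pmf_replicate:
  "map_pmf (map f) (seq_pmf (replicate m p)) = seq_pmf (replicate m (map_pmf f p))"
proof (induction m)
  case (Suc m)
  then show ?case by (simp add: map_bind_pmf bind_map_pmf map_pmf_comp flip: Suc)
qed simp

lemma run_repeat_tests:
  "run_algorithm n H \<psi> (repeat_tests m ps k) =
    bind_pmf (seq_pmf (replicate m (map_pmf (decode False) (run_circuit n H \<psi> (test_circuit ps)))))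
      (\<lambda>dss. map_pmf (\<lambda>(cs, x). (replicate m (test_circuit ps) @ cs, x)) (run_algorithm n H \<psi> (k dss)))"
  unfolding repeat_tests_def run_repeat_query by (simp add: bind_map_pmf flip: map_seq_pmf_replicate)

text \<open>The phase of the extra test turns its cosine into \<open>sin ((e - x0) / W)\<close>. Its
  outcome is the head of the decoded list, the ladder outcomes are the tail.\<close>

definition refine_tests :: "nat \<Rightarrow> nat \<Rightarrow> real \<Rightarrow> real \<Rightarrow> (real \<times> real) list" where
  "refine_tests R L W x0 = (1 / W, - (x0 / W) - pi / 2) # ladder R L"

definition refine_output :: "nat \<Rightarrow> nat \<Rightarrow> real \<Rightarrow> real \<Rightarrow> nat \<Rightarrow> real \<Rightarrow> bool list list \<Rightarrow> real" where
  "refine_output R L W s M x0 dss = refine W s x0 M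
     (\<lambda>i. estimate R L (tl (dss ! i)) \<le> x0 + W / 2) (\<lambda>i. hd (dss ! i))"

text \<open>The second stage is run only if \<open>W\<close> is known to be a lower bound for the gap.\<close>

definition two_stage :: "real \<Rightarrow> nat \<Rightarrow> nat \<Rightarrow> real \<Rightarrow> real \<Rightarrow> nat \<Rightarrow> nat \<Rightarrow> bool \<Rightarrow> algorithm" where
  "two_stage \<eta> R L W s M1 M2 refining = repeat_tests M1 (ladder R L) (\<lambda>dss.
     let x0 = quantile \<eta> (W / 8) M1 (\<lambda>i. estimate R L (dss ! i)) in
     if refining then repeat_tests M2 (refine_tests R L W x0) (\<lambda>dss. Output (refine_output R L W s M2 x0 dss))
     else Output x0)"

text \<open>These facts concern the whole support, so they also cover runs whose estimates
  fail.\<close>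

lemma two_stage_circuits:
  assumes "(cs, x) \<in> set_pmf (run_algorithm n H \<psi> (two_stage \<eta> R L W s M1 M2 refining))"
  shows "length cs \<le> M1 + M2"
    and "\<forall>c\<in>set cs. c = test_circuit (ladder R L) \<or> (\<exists>x0. c = test_circuit (refine_tests R L W x0))"
  using assms
  by (auto simp: two_stage_def run_repeat_tests Let_def case_prod_beta split: if_splits)

context eigenbasis
begin

text \<open>On a fixed eigenstate the outcomes are independent, so selecting runs by the ladder does
  not bias the extra test. This provides the assumption \<open>ground\<close> of
  \<open>prob_refine\<close>.\<close>

lemma tests_pmf_Cons_event:
  "measure_pmf.prob (tests_pmf (p # ps) e) {ds. A (tl ds) \<and> hd ds}
    = hadamard_prob e p * measure_pmf.prob (tests_pmf ps e) {ds. A ds}"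
  "measure_pmf.prob (tests_pmf (p # ps) e) {ds. A (tl ds)} = measure_pmf.prob (tests_pmf ps e) {ds. A ds}"
  using hadamard_prob_bounds[of e p]
  by (simp_all add: tests_pmf_def prob_bind_pmf vimage_def algebra_simps)

text \<open>The failure probability is split into five shares \<open>\<delta> / 5\<close>: two for
  the quantile, three for the refinement.\<close>

lemma prob_two_stage:
  fixes \<gamma> :: "nat \<Rightarrow> complex" and \<eta> \<delta> W s :: real
  assumes E0: "\<And>j. j < N \<Longrightarrow> E 0 \<le> E j \<and> 0 \<le> E j \<and> E j \<le> pi"
    and norm: "sq_norm (eigen_comb \<gamma>) = 1" and \<eta>: "0 < \<eta>" "\<eta> \<le> (cmod (\<gamma> 0))\<^sup>2"
    and W: "0 < W" and s: "0 < s" "s \<le> 1 / 32" and R: "0 < R" "4 * Suc L * exp (- (R / 256)) \<le> s * \<eta> / 2"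
    and L: "16 / W \<le> 2 ^ L"
    and gap: "\<And>j. refining \<Longrightarrow> 1 \<le> j \<Longrightarrow> j < N \<Longrightarrow> E 0 + W \<le> E j"
    and M1: "exp (- (M1 * \<eta> / 32)) \<le> \<delta> / 5"
    and M2: "exp (- (M2 * \<eta> / 32)) \<le> \<delta> / 5" "exp (- (s\<^sup>2 * M2 * \<eta> / 8)) \<le> \<delta> / 5"
    and \<epsilon>: "32 * s * W \<le> \<epsilon>" "\<not> refining \<Longrightarrow> W / 4 \<le> \<epsilon>"
  shows "measure_pmf.prob (run_algorithm n H (eigen_comb \<gamma>) (two_stage \<eta> R L W s M1 M2 refining))
    {(cs, x). \<bar>x - E 0\<bar> \<le> \<epsilon>} \<ge> 1 - \<delta>"
proof -
  define w where "w j = (cmod (\<gamma> j))\<^sup>2" for j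
  define Q where "Q ps = map_pmf (decode False) (run_circuit n H (eigen_comb \<gamma>) (test_circuit ps))" for ps
  let ?q = "s * \<eta> / 2"
  have Npos: "0 < N" by simp
  have mix: "measure_pmf.prob (Q ps) S = (\<Sum>j<N. w j * measure_pmf.prob (tests_pmf ps (E j)) S)" for ps S
    unfolding Q_def w_def by (rule prob_run_test_circuit[OF norm])
  \<comment> \<open>For the empty list of tests and the whole space, the mixture identity says that
    the weights add up to 1.\<close>
  have wsum: "(\<Sum>j<N. w j) = 1" using mix[of "[]" UNIV] by simp
  \<comment> \<open>Strictness makes an error of exactly \<open>W / 8\<close> a sign of inconsistent
    data.\<close>
  have "pi / (3 * 2 ^ L) < W / 8"
  proof -
    have "pi / 3 < 2" using pi_less_4 by simp
    also have "2 \<le> W / 8 * 2 ^ L" using L W by (simp add: field_simps)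
    finally show ?thesis by (simp add: field_simps)
  qed
  then have sub: "{ds. W / 8 \<le> \<bar>estimate R L ds - E j\<bar>} \<subseteq> {ds. \<not> consistent R L ds (E j)}" for j
    using estimate_close[OF _ R(1)] by fastforce
  have est: "measure_pmf.prob (tests_pmf (ladder R L) (E j)) {ds. W / 8 \<le> \<bar>estimate R L ds - E j\<bar>} \<le> ?q"
    if "j < N" for j
    using measure_pmf.finite_measure_mono[OF sub, of j "tests_pmf (ladder R L) (E j)"]
      prob_not_consistent[of "E j" R L] E0[OF that] R(2) by simp
  have q: "?q \<le> \<eta> / 16" using s \<eta> by simp
  interpret one: overlap_mixture N w E "Q (ladder R L)" "\<lambda>j. tests_pmf (ladder R L) (E j)" "estimate R L" \<eta> "W / 8" ?q
    by unfold_locales (use mix wsum Npos \<eta> E0 est q W in \<open>auto simp: w_def\<close>)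
  define x0 where "x0 dss = quantile \<eta> (W / 8) M1 (\<lambda>i. estimate R L (dss ! i))" for dss
  define second where "second dss = run_algorithm n H (eigen_comb \<gamma>)
    (if refining then repeat_tests M2 (refine_tests R L W (x0 dss)) (\<lambda>ess. Output (refine_output R L W s M2 (x0 dss) ess))
     else Output (x0 dss))" for dss
  let ?bad = "{(cs :: circuit list, x). \<not> \<bar>x - E 0\<bar> \<le> \<epsilon>}"
  let ?G = "{dss. \<bar>x0 dss - E 0\<bar> \<le> W / 4}"
  have pre: "(\<lambda>(cs, x). (ds @ cs, x)) -` ?bad = ?bad" for ds by auto
  have two: "measure_pmf.prob (second dss) ?bad \<le> 3 * (\<delta> / 5)" if "dss \<in> ?G" for dss
  proof (cases refining)
    case False
    then have "(([] :: circuit list), x0 dss) \<notin> ?bad" using that \<epsilon>(2) by auto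
    moreover have "0 \<le> \<delta> / 5" using M1 exp_ge_zero order_trans by blast
    ultimately show ?thesis using False by (simp add: second_def indicator_def)
  next
    case True
    let ?ps = "refine_tests R L W (x0 dss)"
    let ?A = "\<lambda>ds. estimate R L (tl ds) \<le> x0 dss + W / 2"
    interpret two: overlap_mixture N w E "Q ?ps" "\<lambda>j. tests_pmf ?ps (E j)" "\<lambda>ds. estimate R L (tl ds)" \<eta> "W / 8" ?q
    proof unfold_locales
      show "measure_pmf.prob (tests_pmf ?ps (E j)) {ds. W / 8 \<le> \<bar>estimate R L (tl ds) - E j\<bar>} \<le> ?q" if "j < N" for j
        unfolding refine_tests_def tests_pmf_Cons_event(2)[where A = "\<lambda>ds. W / 8 \<le> \<bar>estimate R L ds - E j\<bar>"]
        by (rule est[OF that])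
    qed (use mix wsum Npos \<eta> E0 q W in \<open>auto simp: w_def\<close>)
    have h: "hadamard_prob (E 0) (1 / W, - (x0 dss / W) - pi / 2) = sine_prob W (x0 dss) (E 0)"
    proof -
      have "1 / W * E 0 + (- (x0 dss / W) - pi / 2) = (E 0 - x0 dss) / W - pi / 2"
        by (simp add: diff_divide_distrib)
      then show ?thesis by (simp only: hadamard_prob_def sine_prob_def fst_conv snd_conv cos_diff) simp
    qed
    have "measure_pmf.prob (second dss) ?bad
      = measure_pmf.prob (seq_pmf (replicate M2 (Q ?ps))) {xs. \<not> \<bar>refine_output R L W s M2 (x0 dss) xs - E 0\<bar> \<le> \<epsilon>}"
      using True by (simp add: second_def run_repeat_tests Q_def[symmetric] map_pmf_def[symmetric] vimage_def)
    also have "\<dots> \<le> measure_pmf.prob (seq_pmf (replicate M2 (Q ?ps)))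
        {xs. \<not> \<bar>refine W s (x0 dss) M2 (\<lambda>i. ?A (xs ! i)) (\<lambda>i. hd (xs ! i)) - E 0\<bar> \<le> 32 * s * W}"
      by (rule measure_pmf.finite_measure_mono) (use \<epsilon>(1) in \<open>auto simp: refine_output_def\<close>)
    also have "\<dots> \<le> exp (- (M2 * \<eta> / 32)) + 2 * exp (- (s\<^sup>2 * M2 * \<eta> / 8))"
    proof (rule two.prob_refine)
      show "measure_pmf.prob (tests_pmf ?ps (E 0)) {ds. ?A ds \<and> hd ds}
          = sine_prob W (x0 dss) (E 0) * measure_pmf.prob (tests_pmf ?ps (E 0)) {ds. ?A ds}"
        unfolding refine_tests_def tests_pmf_Cons_event[where A = "\<lambda>ds. estimate R L ds \<le> x0 dss + W / 2"] h ..
    qed (use that gap True s in auto)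
    finally show ?thesis using M2 by simp
  qed
  have "measure_pmf.prob (run_algorithm n H (eigen_comb \<gamma>) (two_stage \<eta> R L W s M1 M2 refining)) ?bad
      \<le> 2 * (\<delta> / 5) + 3 * (\<delta> / 5)"
  proof -
    have "run_algorithm n H (eigen_comb \<gamma>) (two_stage \<eta> R L W s M1 M2 refining)
        = bind_pmf (seq_pmf (replicate M1 (Q (ladder R L))))
          (\<lambda>dss. map_pmf (\<lambda>(cs, x). (replicate M1 (test_circuit (ladder R L)) @ cs, x)) (second dss))"
      unfolding two_stage_def run_repeat_tests Q_def second_def x0_def Let_def ..
    moreover have "measure_pmf.prob (bind_pmf (seq_pmf (replicate M1 (Q (ladder R L))))
          (\<lambda>dss. map_pmf (\<lambda>(cs, x). (replicate M1 (test_circuit (ladder R L)) @ cs, x)) (second dss))) ?bad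
        \<le> 2 * (\<delta> / 5) + 3 * (\<delta> / 5)"
    proof (rule prob_bind_pmf_le[where G = ?G])
      show "measure_pmf.prob (map_pmf (\<lambda>(cs, x). (replicate M1 (test_circuit (ladder R L)) @ cs, x)) (second dss)) ?bad
          \<le> 3 * (\<delta> / 5)" if "dss \<in> ?G" for dss
        using two[OF that] by (simp only: measure_map_pmf pre)
      have "- ?G = {dss. \<not> \<bar>quantile \<eta> (W / 8) M1 (\<lambda>i. estimate R L (dss ! i)) - E 0\<bar> \<le> 2 * (W / 8)}"
        by (auto simp: x0_def)
      then show "measure_pmf.prob (seq_pmf (replicate M1 (Q (ladder R L)))) (- ?G) \<le> 2 * (\<delta> / 5)"
        using one.prob_quantile[of M1] M1 by simp
      show "0 \<le> 3 * (\<delta> / 5)" using order_trans[OF exp_ge_zero M1] by simp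
    qed
    ultimately show ?thesis by simp
  qed
  moreover have "{(cs :: circuit list, x). \<bar>x - E 0\<bar> \<le> \<epsilon>} = UNIV - ?bad" by auto
  ultimately show ?thesis
    using measure_pmf.prob_compl[of ?bad "run_algorithm n H (eigen_comb \<gamma>) (two_stage \<eta> R L W s M1 M2 refining)"] by simp
qed

end

subsection \<open>Parameters and costs\<close>

lemma log1_ge_one: "1 \<le> log1 x"
  by (simp add: log1_def)

lemma ln_le_log1: "ln x \<le> log1 x"
  by (simp add: log1_def)

lemma le_soft_O:
  assumes "0 \<le> C" "0 \<le> f" "g \<le> C * f"
  shows "g \<le> soft_O C p f"
proof -
  have "C * f * 1 \<le> C * f * log1 f ^ p"
    using assms by (intro mult_left_mono one_le_power log1_ge_one) auto
  then show ?thesis using assms unfolding soft_O_def by simp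
qed

text \<open>The number \<open>s\<close> is the statistical accuracy that turns the error \<open>32 s W\<close> of the second stage
  into \<open>\<epsilon>\<close>, and \<open>R\<close> makes an estimate fail with probability at most \<open>s \<eta> / 2\<close>. If
  \<open>\<pi> \<le> \<epsilon>\<close>, no circuit may be run, as the allowed number of gates can be less than 1.\<close>

definition gap_estimation :: "real \<Rightarrow> real \<Rightarrow> real \<Rightarrow> real \<Rightarrow> algorithm" where
  "gap_estimation \<eta> \<epsilon> \<delta> D = (if pi \<le> \<epsilon> then Output 0 else
     let W = max D \<epsilon>; s = \<epsilon> / (32 * W); L = nat \<lceil>log 2 (16 / W)\<rceil>;
       R = nat \<lceil>256 * ln (8 * Suc L / (s * \<eta>))\<rceil>;
       M1 = nat \<lceil>32 / \<eta> * ln (5 / \<delta>)\<rceil>; M2 = nat \<lceil>8 / (s\<^sup>2 * \<eta>) * ln (5 / \<delta>)\<rceil>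
     in two_stage \<eta> R L W s M1 M2 (\<epsilon> < D))"

lemma nat_ceiling_log2:
  fixes W :: real
  assumes "0 < W" "W \<le> 16"
  defines "L \<equiv> nat \<lceil>log 2 (16 / W)\<rceil>"
  shows "16 / W \<le> 2 ^ L" "2 ^ L \<le> 32 / W" "L \<le> log 2 (16 / W) + 1"
proof -
  have pos: "0 < 16 / W" and nn: "0 \<le> log 2 (16 / W)" using assms by (auto simp: field_simps)
  have up: "real L \<le> log 2 (16 / W) + 1" and lo: "log 2 (16 / W) \<le> L" using nn unfolding L_def by linarith+
  show "L \<le> log 2 (16 / W) + 1" by (rule up)
  have p: "2 powr (log 2 (16 / W)) = 16 / W" by (rule powr_log_cancel) (use pos in auto)
  have L: "(2::real) ^ L = 2 powr L" by (simp add: powr_realpow)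
  show "16 / W \<le> 2 ^ L" unfolding L using powr_mono[OF lo, of 2] p by simp
  show "2 ^ L \<le> 32 / W" unfolding L using powr_mono[OF up, of 2] p by (simp add: powr_add)
qed

lemma (in eigenbasis) prob_gap_estimation:
  assumes E0: "\<And>j. j < N \<Longrightarrow> E 0 \<le> E j \<and> 0 \<le> E j \<and> E j \<le> pi"
    and norm: "sq_norm (eigen_comb \<gamma>) = 1" and \<eta>: "0 < \<eta>" "\<eta> < 1" "\<eta> \<le> (cmod (\<gamma> 0))\<^sup>2"
    and D: "D \<le> max \<epsilon> pi" and \<epsilon>: "0 < \<epsilon>" and \<delta>: "0 < \<delta>" "\<delta> < 1"
    and gap: "\<And>j. \<epsilon> < D \<Longrightarrow> 1 \<le> j \<Longrightarrow> j < N \<Longrightarrow> E 0 + D \<le> E j"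
  shows "measure_pmf.prob (run_algorithm n H (eigen_comb \<gamma>) (gap_estimation \<eta> \<epsilon> \<delta> D))
    {(cs, x). \<bar>x - E 0\<bar> \<le> \<epsilon>} \<ge> 1 - \<delta>"
proof (cases "pi \<le> \<epsilon>")
  case True
  \<comment> \<open>The output 0 is accurate because \<open>E 0\<close> lies between 0 and
    \<open>pi\<close>.\<close>
  then show ?thesis using E0[of 0] \<delta> by (simp add: gap_estimation_def indicator_def)
next
  case False
  define W where "W = max D \<epsilon>"
  define s where "s = \<epsilon> / (32 * W)"
  define L where "L = nat \<lceil>log 2 (16 / W)\<rceil>"
  define R where "R = nat \<lceil>256 * ln (8 * Suc L / (s * \<eta>))\<rceil>"
  define M1 where "M1 = nat \<lceil>32 / \<eta> * ln (5 / \<delta>)\<rceil>"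
  define M2 where "M2 = nat \<lceil>8 / (s\<^sup>2 * \<eta>) * ln (5 / \<delta>)\<rceil>"
  have W: "0 < W" "W \<le> 16" "\<epsilon> \<le> W"
    using \<epsilon> D False pi_less_4 by (auto simp: W_def max_def)
  have s: "0 < s" "s \<le> 1 / 32" using \<epsilon> W by (auto simp: s_def field_simps)
  have l: "0 < ln (5 / \<delta>)" using \<delta> by (intro ln_gt_zero) (simp add: field_simps)
  have e: "exp (- x) \<le> \<delta> / 5" if "ln (5 / \<delta>) \<le> x" for x
  proof -
    have "exp (- x) \<le> exp (- ln (5 / \<delta>))" using that by simp
    then show ?thesis using \<delta> by (simp add: exp_minus)
  qed
  have s\<eta>: "s * \<eta> < 1" "0 < s * \<eta>" using s \<eta> mult_strict_mono[of s 1 \<eta> 1] by auto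
  have arg: "1 < 8 * Suc L / (s * \<eta>)" using s\<eta> by (simp add: field_simps)
  have R0: "256 * ln (8 * Suc L / (s * \<eta>)) \<le> R" unfolding R_def by linarith
  moreover have "0 < ln (8 * Suc L / (s * \<eta>))" using arg by (rule ln_gt_zero)
  ultimately have Rpos: "0 < R" by linarith
  have "exp (- (R / 256)) \<le> exp (- ln (8 * Suc L / (s * \<eta>)))" using R0 by simp
  also have "\<dots> = s * \<eta> / (8 * Suc L)"
    using arg s\<eta> by (simp add: exp_minus)
  finally have "4 * Suc L * exp (- (R / 256)) \<le> 4 * Suc L * (s * \<eta> / (8 * Suc L))"
    by (intro mult_left_mono) auto
  also have "\<dots> = s * \<eta> / 2" by (simp add: field_simps del: of_nat_Suc)
  finally have R: "4 * Suc L * exp (- (R / 256)) \<le> s * \<eta> / 2" .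
  have M1: "exp (- (M1 * \<eta> / 32)) \<le> \<delta> / 5"
  proof (rule e)
    have "32 / \<eta> * ln (5 / \<delta>) \<le> M1" unfolding M1_def by linarith
    then show "ln (5 / \<delta>) \<le> M1 * \<eta> / 32" using \<eta> by (simp add: field_simps)
  qed
  have M2': "8 / (s\<^sup>2 * \<eta>) * ln (5 / \<delta>) \<le> M2" unfolding M2_def by linarith
  then have M2b: "ln (5 / \<delta>) \<le> s\<^sup>2 * M2 * \<eta> / 8" using s \<eta> by (simp add: field_simps)
  \<comment> \<open>\<open>M2\<close> is chosen for the accuracy of the frequency; since
    \<open>s\<close> is small, it also guarantees enough kept runs.\<close>
  have "s\<^sup>2 \<le> 1 / 4" using s power_mono[of s "1 / 2" 2] by (simp add: power_divide)
  then have "s\<^sup>2 * (M2 * \<eta> / 8) \<le> 1 / 4 * (M2 * \<eta> / 8)" using \<eta> by (intro mult_right_mono) auto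
  then have M2a: "ln (5 / \<delta>) \<le> M2 * \<eta> / 32" using M2b by (simp add: field_simps)
  have "measure_pmf.prob (run_algorithm n H (eigen_comb \<gamma>) (two_stage \<eta> R L W s M1 M2 (\<epsilon> < D)))
    {(cs, x). \<bar>x - E 0\<bar> \<le> \<epsilon>} \<ge> 1 - \<delta>"
  proof (rule prob_two_stage[OF E0 norm \<eta>(1,3) W(1) s Rpos R])
    show "16 / W \<le> 2 ^ L" unfolding L_def by (rule nat_ceiling_log2(1)[OF W(1,2)])
    show "E 0 + W \<le> E j" if "\<epsilon> < D" "1 \<le> j" "j < N" for j
      using gap[OF that] that by (simp add: W_def)
    show "exp (- (M2 * \<eta> / 32)) \<le> \<delta> / 5" by (rule e[OF M2a])
    show "exp (- (s\<^sup>2 * M2 * \<eta> / 8)) \<le> \<delta> / 5" by (rule e[OF M2b])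
    show "32 * s * W \<le> \<epsilon>" using W by (simp add: s_def)
    show "W / 4 \<le> \<epsilon>" if "\<not> \<epsilon> < D" using that \<epsilon> by (simp add: W_def)
  qed (use M1 in auto)
  then show ?thesis
    using False by (simp only: gap_estimation_def Let_def W_def s_def L_def R_def M1_def M2_def if_False)
qed

section \<open>Evolution times, gate counts and their asymptotic bounds\<close>

lemma fst_ladder_le: "p \<in> set (ladder R L) \<Longrightarrow> \<bar>fst p\<bar> \<le> 2 ^ L"
proof -
  assume "p \<in> set (ladder R L)"
  then obtain i where i: "i < 2 * Suc L * R" "p = ladder_test (i div R)" by (auto simp: ladder_def)
  then have "i div R < 2 * Suc L" by (simp add: less_mult_imp_div_less)
  then have "i div R div 2 \<le> L" by simp
  then show ?thesis by (simp add: i ladder_test_def)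
qed

lemma sum_list_fst_ladder: "(\<Sum>p\<leftarrow>ladder R L. \<bar>fst p\<bar>) \<le> 2 * Suc L * R * 2 ^ L"
proof -
  have "(\<Sum>p\<leftarrow>ladder R L. \<bar>fst p\<bar>) \<le> (\<Sum>p\<leftarrow>ladder R L. 2 ^ L)"
    using fst_ladder_le by (intro sum_list_mono) auto
  then show ?thesis by (simp add: sum_list_triv ladder_def)
qed

text \<open>One bound for time and gates. The 6 comes from two gates for each of at most
  \<open>2 * Suc L * R + 1\<close> tests; the time takes half of it, with \<open>1 / W\<close> for
  the extra test.\<close>

lemma test_circuit_costs:
  assumes W: "0 < W" "1 / W \<le> 2 ^ L" and R: "0 < R"
    and c: "c = test_circuit (ladder R L) \<or> (\<exists>x0. c = test_circuit (refine_tests R L W x0))"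
  shows "valid_circuit n c" "evolution_time c \<le> 6 * Suc L * R * 2 ^ L" "gate_count c \<le> 6 * Suc L * R * 2 ^ L"
proof -
  show "valid_circuit n c" using c valid_test_circuit by auto
  have pos: "1 \<le> Suc L * R" using R by simp
  then have one: "1 \<le> real (Suc L) * real R" by (metis of_nat_1 of_nat_le_iff of_nat_mult)
  then have "1 * 2 ^ L \<le> real (Suc L) * real R * 2 ^ L" by (intro mult_right_mono) auto
  then have "2 ^ L \<le> real (Suc L) * real R * 2 ^ L" by simp
  moreover have "(\<Sum>p\<leftarrow>ladder R L. \<bar>fst p\<bar>) \<le> 2 * (real (Suc L) * real R * 2 ^ L)"
    using sum_list_fst_ladder[of R L] by (simp add: algebra_simps)
  moreover have "evolution_time c \<le> 1 / W + (\<Sum>p\<leftarrow>ladder R L. \<bar>fst p\<bar>)"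
    using c W by (auto simp: evolution_time_test_circuit refine_tests_def)
  ultimately have "evolution_time c \<le> 3 * (real (Suc L) * real R * 2 ^ L)" using W(2) by linarith
  moreover have "0 \<le> real (Suc L) * real R * 2 ^ L" by simp
  moreover have "6 * Suc L * R * 2 ^ L = 6 * (real (Suc L) * real R * 2 ^ L)" by (simp add: algebra_simps)
  ultimately show "evolution_time c \<le> 6 * Suc L * R * 2 ^ L" by linarith
  have "gate_count c \<le> 2 * (2 * Suc L * R + 1)"
    using c by (auto simp: gate_count_test_circuit refine_tests_def ladder_def)
  also have "\<dots> \<le> 6 * Suc L * R * 1" using pos by (simp add: algebra_simps)
  also have "\<dots> \<le> 6 * Suc L * R * 2 ^ L" by (intro mult_left_mono) auto
  finally show "gate_count c \<le> 6 * Suc L * R * 2 ^ L" .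
qed

text \<open>When \<open>\<epsilon>\<close> dominates, \<open>W\<close> can be far larger than
  \<open>\<Delta>0\<close>, and the logarithm exceeds the target by \<open>ln (1 / y)\<close>. The
  factor \<open>1 / W\<close> pays for this, because \<open>y * ln (1 / y)\<close> is
  bounded.\<close>

lemma ln_ratio_bound:
  fixes c W \<Delta>0 \<epsilon> \<eta> :: real
  assumes "0 < c" "0 < \<Delta>0" "0 < \<epsilon>" "0 < \<eta>" "0 < W" and cW: "c * \<Delta>0 \<le> W"
  shows "1 / W * (1 + ln (W / (\<epsilon> * \<eta>))) \<le> (2 / c + 1) * (1 / \<Delta>0 * log1 (\<Delta>0 / (\<epsilon> * \<eta>)))"
proof -
  define y where "y = \<Delta>0 / W"
  define g where "g = log1 (\<Delta>0 / (\<epsilon> * \<eta>))"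
  have g: "1 \<le> g" by (simp add: g_def log1_ge_one)
  have y: "0 < y" "y \<le> 1 / c" using assms by (auto simp: y_def field_simps)
  have "W / (\<epsilon> * \<eta>) = \<Delta>0 / (\<epsilon> * \<eta>) * (1 / y)" using assms by (simp add: y_def)
  then have "ln (W / (\<epsilon> * \<eta>)) = ln (\<Delta>0 / (\<epsilon> * \<eta>)) + ln (1 / y)"
    using assms y by (simp only:) (subst ln_mult, auto)
  also have "\<dots> \<le> g + (1 / y - 1)"
    using ln_le_minus_one[of "1 / y"] y ln_le_log1 unfolding g_def by (intro add_mono) auto
  finally have "y * (1 + ln (W / (\<epsilon> * \<eta>))) \<le> y * (g + 1 / y)" using y by (intro mult_left_mono) auto
  also have "\<dots> = y * g + 1" using y by (simp add: field_simps)
  also have "\<dots> \<le> 1 / c * g + g" using y g by (intro add_mono mult_right_mono) auto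
  also have "\<dots> \<le> (2 / c + 1) * g" using assms(1) g by (simp add: field_simps)
  finally have "1 / \<Delta>0 * (y * (1 + ln (W / (\<epsilon> * \<eta>)))) \<le> 1 / \<Delta>0 * ((2 / c + 1) * g)"
    using assms by (intro mult_left_mono) auto
  then show ?thesis using assms by (simp add: y_def g_def mult_ac)
qed

text \<open>One factor \<open>Suc L\<close> counts the scales, the other bounds the
  \<open>ln (Suc L)\<close> inside \<open>R\<close>. Each is of order \<open>log1 f\<close> because
  \<open>1 / W \<le> f / c\<close>, which explains the exponent 2; the rest is of order
  \<open>f\<close>.\<close>

lemma depth_bound:
  fixes c W \<Delta>0 \<epsilon> \<eta> :: real
  assumes c: "0 < c" "c \<le> 1" and pos: "0 < \<Delta>0" "0 < \<epsilon>" "0 < \<eta>" "\<eta> < 1"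
    and W: "\<epsilon> \<le> W" "W \<le> 16" "c * \<Delta>0 \<le> W"
  defines "L \<equiv> nat \<lceil>log 2 (16 / W)\<rceil>"
  defines "R \<equiv> nat \<lceil>256 * ln (8 * Suc L / (\<epsilon> / (32 * W) * \<eta>))\<rceil>"
  shows "6 * Suc L * R * 2 ^ L \<le> soft_O (442368 * (2 / c + 1) * (8 + 2 / c)\<^sup>2) 2
    (1 / \<Delta>0 * log1 (\<Delta>0 / (\<epsilon> * \<eta>)))"
proof -
  define f where "f = 1 / \<Delta>0 * log1 (\<Delta>0 / (\<epsilon> * \<eta>))"
  have W0: "0 < W" using pos W by simp
  have inv\<Delta>: "1 / \<Delta>0 \<le> f"
    unfolding f_def using pos mult_left_mono[OF log1_ge_one, of "1 / \<Delta>0"] by simp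
  then have f0: "0 < f" using pos by (smt (verit) divide_pos_pos)
  have "1 / W \<le> 1 / (c * \<Delta>0)" using W c pos by (intro divide_left_mono) auto
  also have "\<dots> \<le> f * (1 / c)" using inv\<Delta> c by (simp add: field_simps)
  finally have invW: "1 / W \<le> f * (1 / c)" .
  have "ln (1 / W) \<le> ln (f * (1 / c))" using invW W0 by (intro ln_mono) auto
  also have "\<dots> = ln f + ln (1 / c)" using f0 c by (intro ln_mult_pos) auto
  also have "\<dots> \<le> log1 f + (1 / c - 1)"
    using ln_le_minus_one[of "1 / c"] c ln_le_log1 by (intro add_mono) auto
  finally have lnW: "ln (1 / W) \<le> log1 f + 1 / c" by simp
  have "real (Suc L) \<le> log 2 (16 / W) + 2"
    using nat_ceiling_log2(3)[OF W0 W(2)] by (simp add: L_def)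
  also have "log 2 (16 / W) = 4 + ln (1 / W) / ln 2"
  proof -
    have "log 2 (16 / W) = log 2 (2 ^ 4 * (1 / W))" by simp
    also have "\<dots> = log 2 (2 ^ 4) + log 2 (1 / W)" using W0 by (intro log_mult_pos) auto
    also have "log 2 ((2 :: real) ^ 4) = 4" by (simp only: log_pow_cancel)
    finally show ?thesis by (simp add: log_def)
  qed
  also have "ln (1 / W) / ln 2 \<le> 2 * (log1 f + 1 / c)"
  proof -
    have "1 / 2 \<le> ln (2 :: real)" using ln2_ge_two_thirds by simp
    moreover have "0 \<le> log1 f + 1 / c" using log1_ge_one[of f] c by (simp add: add_nonneg_nonneg)
    ultimately have "log1 f + 1 / c \<le> 2 * (log1 f + 1 / c) * ln 2"
      using mult_left_mono[of "1 / 2" "ln 2" "2 * (log1 f + 1 / c)"] by simp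
    then show ?thesis using lnW by (simp add: field_simps)
  qed
  finally have "real (Suc L) \<le> 6 + 2 / c + 2 * log1 f" by simp
  also have "\<dots> \<le> (6 + 2 / c) * log1 f + 2 * log1 f"
    using mult_left_mono[OF log1_ge_one[of f], of "6 + 2 / c"] c by simp
  finally have L: "real (Suc L) \<le> (8 + 2 / c) * log1 f" by (simp add: algebra_simps)
  have w: "1 \<le> W / (\<epsilon> * \<eta>)"
  proof -
    have "\<epsilon> * \<eta> \<le> W * 1" using pos W by (intro mult_mono) auto
    then show ?thesis using pos by simp
  qed
  then have lnw: "0 \<le> ln (W / (\<epsilon> * \<eta>))" by simp
  \<comment> \<open>\<open>2 ^ 8\<close> combines the 8 in \<open>R\<close> with the 32 in
    \<open>s\<close>.\<close>
  have eq: "8 * Suc L / (\<epsilon> / (32 * W) * \<eta>) = 2 ^ 8 * (Suc L * (W / (\<epsilon> * \<eta>)))"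
    using W0 pos by (simp add: field_simps)
  have "ln (8 * Suc L / (\<epsilon> / (32 * W) * \<eta>)) = 8 * ln 2 + (ln (Suc L) + ln (W / (\<epsilon> * \<eta>)))"
    unfolding eq
    using w ln_mult_pos[of "2 ^ 8" "Suc L * (W / (\<epsilon> * \<eta>))"] ln_mult_pos[of "Suc L" "W / (\<epsilon> * \<eta>)"] ln_realpow[of 2 8]
    by (simp del: of_nat_Suc times_divide_eq_right)
  also have "\<dots> \<le> 8 + (real L + ln (W / (\<epsilon> * \<eta>)))"
    using ln_le_minus_one[of "2 :: real"] ln_le_minus_one[of "real (Suc L)"] by (intro add_mono) auto
  finally have ln: "ln (8 * Suc L / (\<epsilon> / (32 * W) * \<eta>)) \<le> 8 + L + ln (W / (\<epsilon> * \<eta>))" by simp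
  have "1 \<le> 8 * Suc L / (\<epsilon> / (32 * W) * \<eta>)"
  proof -
    have "1 * 1 \<le> Suc L * (W / (\<epsilon> * \<eta>))" using w by (intro mult_mono) auto
    then show ?thesis unfolding eq by simp
  qed
  then have "0 \<le> ln (8 * Suc L / (\<epsilon> / (32 * W) * \<eta>))" by simp
  then have "R \<le> 256 * ln (8 * Suc L / (\<epsilon> / (32 * W) * \<eta>)) + 1" unfolding R_def by linarith
  also have "\<dots> \<le> 256 * (8 + L + ln (W / (\<epsilon> * \<eta>))) + 1"
    by (intro add_right_mono mult_left_mono ln) simp
  also have "\<dots> \<le> 2304 * (Suc L * (1 + ln (W / (\<epsilon> * \<eta>))))"
  proof -
    have "256 * (8 + l + v) + 1 \<le> 2304 * ((1 + l) * (1 + v))" if "0 \<le> l" "0 \<le> v" for l v :: real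
      using mult_nonneg_nonneg[OF that] that by (simp add: algebra_simps)
    from this[OF of_nat_0_le_iff lnw, of L] show ?thesis by (simp only: of_nat_Suc of_nat_add of_nat_numeral)
  qed
  finally have R: "R \<le> 2304 * (Suc L * (1 + ln (W / (\<epsilon> * \<eta>))))" .
  have "real R * 2 ^ L \<le> 2304 * (Suc L * (1 + ln (W / (\<epsilon> * \<eta>)))) * (32 / W)"
    using nat_ceiling_log2(2)[OF W0 W(2)] lnw unfolding L_def[symmetric] by (intro mult_mono R) auto
  also have "\<dots> = 73728 * Suc L * (1 / W * (1 + ln (W / (\<epsilon> * \<eta>))))" by (simp add: field_simps)
  also have "\<dots> \<le> 73728 * Suc L * ((2 / c + 1) * f)"
    using ln_ratio_bound[OF c(1) pos(1,2,3) W0 W(3)] by (intro mult_left_mono) (auto simp: f_def)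
  finally have "6 * real (Suc L) * (real R * 2 ^ L) \<le> 6 * real (Suc L) * (73728 * Suc L * ((2 / c + 1) * f))"
    by (intro mult_left_mono) auto
  also have "\<dots> = 442368 * (2 / c + 1) * f * (real (Suc L))\<^sup>2"
  proof -
    have "6 * l * (73728 * l * (k * f)) = 442368 * k * f * l\<^sup>2" for l k :: real
      by (simp add: power2_eq_square)
    then show ?thesis by (simp only: of_nat_mult of_nat_numeral)
  qed
  also have "\<dots> \<le> 442368 * (2 / c + 1) * f * ((8 + 2 / c) * log1 f)\<^sup>2"
    using L c f0 by (intro mult_left_mono power_mono) auto
  finally have "6 * real (Suc L) * (real R * 2 ^ L) \<le> soft_O (442368 * (2 / c + 1) * (8 + 2 / c)\<^sup>2) 2 f"
    by (simp only: soft_O_def power_mult_distrib mult_ac)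
  moreover have "real (6 * Suc L * R * 2 ^ L) = 6 * real (Suc L) * (real R * 2 ^ L)"
    by (simp only: of_nat_mult of_nat_power of_nat_numeral mult.assoc)
  ultimately show ?thesis by (simp only: f_def)
qed

text \<open>If \<open>D \<le> \<epsilon>\<close>, the ratio
  \<open>max D \<epsilon> / \<epsilon>\<close> is 1 rather than small;
  \<open>log1 (1 / \<Delta>0)\<close>, being at least 1, absorbs this constant. Likewise
  \<open>1 / \<eta> * l\<close> absorbs the two roundings.\<close>

lemma count_bound:
  fixes \<Delta>0 \<epsilon> \<eta> \<delta> D :: real
  assumes pos: "0 < \<epsilon>" "0 < \<eta>" "\<eta> < 1" "0 < \<delta>" "\<delta> < 1" and D: "D \<le> \<Delta>0" "0 < D"
  defines "s \<equiv> \<epsilon> / (32 * max D \<epsilon>)"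
  shows "real (nat \<lceil>32 / \<eta> * ln (5 / \<delta>)\<rceil> + nat \<lceil>8 / (s\<^sup>2 * \<eta>) * ln (5 / \<delta>)\<rceil>)
    \<le> 50000 * (1 / \<eta> * ((\<Delta>0 / \<epsilon>)\<^sup>2 + log1 (1 / \<Delta>0)) * log1 (1 / \<delta>))"
proof -
  define l where "l = log1 (1 / \<delta>)"
  define r where "r = (\<Delta>0 / \<epsilon>)\<^sup>2"
  have l1: "1 \<le> l" unfolding l_def by (rule log1_ge_one)
  have "ln (5 / \<delta>) = ln 5 + ln (1 / \<delta>)"
    using ln_mult[of 5 "1 / \<delta>"] pos by simp
  also have "\<dots> \<le> 4 + l"
    using ln_le_minus_one[of "5 :: real"] ln_le_log1 unfolding l_def by (intro add_mono) auto
  also have "\<dots> \<le> 5 * l" using l1 by simp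
  finally have ln5: "ln (5 / \<delta>) \<le> 5 * l" .
  have ln0: "0 \<le> ln (5 / \<delta>)" using pos by (simp add: field_simps)
  have r: "0 \<le> r" by (simp add: r_def)
  have "(max D \<epsilon> / \<epsilon>)\<^sup>2 \<le> 1 + r"
  proof (cases "D \<le> \<epsilon>")
    case True
    then show ?thesis using pos r by (simp add: max_def)
  next
    case False
    then have "(max D \<epsilon> / \<epsilon>)\<^sup>2 \<le> r"
      unfolding r_def using D pos by (intro power_mono divide_right_mono) auto
    then show ?thesis by simp
  qed
  \<comment> \<open>\<open>8192 = 8 * 32\<^sup>2\<close>.\<close>
  moreover have "8 / (s\<^sup>2 * \<eta>) = 1 / \<eta> * (8192 * (max D \<epsilon> / \<epsilon>)\<^sup>2)"
    using pos D by (simp add: s_def power_divide power_mult_distrib field_simps max_def)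
  ultimately have s: "8 / (s\<^sup>2 * \<eta>) \<le> 1 / \<eta> * (8192 * (1 + r))"
    using pos by (simp only:) (intro mult_left_mono, auto)
  have "real (nat \<lceil>32 / \<eta> * ln (5 / \<delta>)\<rceil>) \<le> 32 / \<eta> * ln (5 / \<delta>) + 1"
    using ln0 pos by (simp add: of_nat_nat)
  also have "\<dots> \<le> 32 / \<eta> * (5 * l) + 1"
    using ln5 pos by (intro add_mono mult_left_mono) auto
  finally have 1: "real (nat \<lceil>32 / \<eta> * ln (5 / \<delta>)\<rceil>) \<le> 1 / \<eta> * (160 * l) + 1" by simp
  have "0 \<le> 8 / (s\<^sup>2 * \<eta>) * ln (5 / \<delta>)" using ln0 pos by simp
  then have "real (nat \<lceil>8 / (s\<^sup>2 * \<eta>) * ln (5 / \<delta>)\<rceil>) \<le> 8 / (s\<^sup>2 * \<eta>) * ln (5 / \<delta>) + 1"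
    by linarith
  also have "\<dots> \<le> 1 / \<eta> * (8192 * (1 + r)) * (5 * l) + 1"
    using s ln5 ln0 r pos by (intro add_mono mult_mono) auto
  finally have 2: "real (nat \<lceil>8 / (s\<^sup>2 * \<eta>) * ln (5 / \<delta>)\<rceil>) \<le> 1 / \<eta> * (40960 * (1 + r) * l) + 1" by (simp add: algebra_simps)
  have "1 \<le> 1 / \<eta> * l"
    using mult_mono[of 1 "1 / \<eta>" 1 l] pos l1 by simp
  then have "real (nat \<lceil>32 / \<eta> * ln (5 / \<delta>)\<rceil> + nat \<lceil>8 / (s\<^sup>2 * \<eta>) * ln (5 / \<delta>)\<rceil>)
      \<le> 1 / \<eta> * (160 * l) + 1 / \<eta> * (40960 * (1 + r) * l) + 2 * (1 / \<eta> * l)"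
    using 1 2 by simp
  also have "\<dots> = 1 / \<eta> * (41122 + 40960 * r) * l" by (simp add: algebra_simps add_divide_distrib)
  also have "\<dots> \<le> 1 / \<eta> * (50000 * (r + log1 (1 / \<Delta>0))) * l"
    using r log1_ge_one[of "1 / \<Delta>0"] pos l1 by (intro mult_right_mono mult_left_mono) auto
  finally show ?thesis by (simp add: l_def r_def mult_ac)
qed

lemma gap_estimation_costs:
  fixes c D \<Delta>0 \<epsilon> \<eta> \<delta> :: real
  assumes c: "0 < c" "c \<le> 1" and \<Delta>0: "0 < \<Delta>0" "\<Delta>0 \<le> max \<epsilon> pi" and D: "c * \<Delta>0 \<le> D" "D \<le> \<Delta>0"
    and pos: "0 < \<epsilon>" "0 < \<eta>" "\<eta> < 1" "0 < \<delta>" "\<delta> < 1"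
    and C: "50000 + 442368 * (2 / c + 1) * (8 + 2 / c)\<^sup>2 \<le> C"
    and mem: "(cs, x) \<in> set_pmf (run_algorithm n H \<psi> (gap_estimation \<eta> \<epsilon> \<delta> D))"
  shows "length cs \<le> soft_O C 2 (1 / \<eta> * ((\<Delta>0 / \<epsilon>)\<^sup>2 + log1 (1 / \<Delta>0)) * log1 (1 / \<delta>))"
    and "\<forall>c\<in>set cs. valid_circuit n c
      \<and> evolution_time c \<le> soft_O C 2 (1 / \<Delta>0 * log1 (\<Delta>0 / (\<epsilon> * \<eta>)))
      \<and> gate_count c \<le> soft_O C 2 (1 / \<Delta>0 * log1 (\<Delta>0 / (\<epsilon> * \<eta>)))"
proof -
  let ?f1 = "1 / \<eta> * ((\<Delta>0 / \<epsilon>)\<^sup>2 + log1 (1 / \<Delta>0)) * log1 (1 / \<delta>)"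
  let ?f2 = "1 / \<Delta>0 * log1 (\<Delta>0 / (\<epsilon> * \<eta>))"
  let ?C = "442368 * (2 / c + 1) * (8 + 2 / c)\<^sup>2"
  have C0: "0 \<le> ?C" using c by simp
  then have C': "0 \<le> C" using C by linarith
  have l0: "0 \<le> log1 z" for z using log1_ge_one[of z] by simp
  have f: "0 \<le> ?f1" "0 \<le> ?f2" using pos \<Delta>0 l0 by auto
  have D0: "0 < D" using c \<Delta>0 D mult_pos_pos[of c \<Delta>0] by linarith
  have "length cs \<le> soft_O C 2 ?f1 \<and> (\<forall>c\<in>set cs. valid_circuit n c
      \<and> evolution_time c \<le> soft_O C 2 ?f2 \<and> gate_count c \<le> soft_O C 2 ?f2)"
  proof (cases "pi \<le> \<epsilon>")
    case True
    then have "cs = []" using mem by (simp add: gap_estimation_def)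
    moreover have "0 \<le> soft_O C 2 ?f1" by (rule le_soft_O[OF C' f(1) mult_nonneg_nonneg[OF C' f(1)]])
    ultimately show ?thesis by simp
  next
    case False
    define W where "W = max D \<epsilon>"
    define s where "s = \<epsilon> / (32 * W)"
    define L where "L = nat \<lceil>log 2 (16 / W)\<rceil>"
    define R where "R = nat \<lceil>256 * ln (8 * Suc L / (s * \<eta>))\<rceil>"
    define M1 where "M1 = nat \<lceil>32 / \<eta> * ln (5 / \<delta>)\<rceil>"
    define M2 where "M2 = nat \<lceil>8 / (s\<^sup>2 * \<eta>) * ln (5 / \<delta>)\<rceil>"
    have mem': "(cs, x) \<in> set_pmf (run_algorithm n H \<psi> (two_stage \<eta> R L W s M1 M2 (\<epsilon> < D)))"
      using mem False by (simp only: gap_estimation_def Let_def W_def s_def L_def R_def M1_def M2_def if_False)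
    have W: "0 < W" "W \<le> 16" "\<epsilon> \<le> W" "c * \<Delta>0 \<le> W"
      using pos D \<Delta>0 False pi_less_4 by (auto simp: W_def max_def)
    have "real (length cs) \<le> real (M1 + M2)" using two_stage_circuits(1)[OF mem'] by simp
    also have "\<dots> \<le> 50000 * ?f1"
      unfolding M1_def M2_def s_def W_def by (rule count_bound[OF pos D(2) D0])
    also have "\<dots> \<le> C * ?f1" using f C C0 by (intro mult_right_mono) auto
    finally have len: "length cs \<le> soft_O C 2 ?f1"
      by (intro le_soft_O f) (use C C0 in auto)
    have depth: "6 * Suc L * R * 2 ^ L \<le> soft_O ?C 2 ?f2"
      unfolding R_def s_def L_def by (rule depth_bound[OF c \<Delta>0(1) pos(1,2,3) W(3,2,4)])
    also have "\<dots> \<le> soft_O C 2 ?f2"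
      unfolding soft_O_def using C f l0 by (intro mult_right_mono) auto
    finally have depth: "6 * Suc L * R * 2 ^ L \<le> soft_O C 2 ?f2" .
    have "s \<le> 1 / 32" "0 < s" using W pos by (auto simp: s_def field_simps)
    then have "0 < s * \<eta>" "s * \<eta> < 1" using pos mult_strict_mono[of s 1 \<eta> 1] by auto
    then have "1 < 8 * Suc L / (s * \<eta>)" by (simp add: field_simps)
    then have R: "0 < R" unfolding R_def by simp
    have "1 / W \<le> 16 / W" using W by (simp add: field_simps)
    then have inv: "1 / W \<le> 2 ^ L" using nat_ceiling_log2(1)[OF W(1,2)] unfolding L_def by linarith
    have "valid_circuit n c \<and> evolution_time c \<le> soft_O C 2 ?f2 \<and> gate_count c \<le> soft_O C 2 ?f2"
      if "c \<in> set cs" for c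
    proof -
      have "c = test_circuit (ladder R L) \<or> (\<exists>x0. c = test_circuit (refine_tests R L W x0))"
        using two_stage_circuits(2)[OF mem'] that by blast
      note costs = test_circuit_costs[OF W(1) inv R this]
      have "real (gate_count c) \<le> real (6 * Suc L * R * 2 ^ L)"
        using costs(3) by (simp only: of_nat_le_iff)
      then show ?thesis using costs(1)[of n] costs(2) depth by simp
    qed
    then show ?thesis using len by blast
  qed
  then show "length cs \<le> soft_O C 2 ?f1" "\<forall>c\<in>set cs. valid_circuit n c
      \<and> evolution_time c \<le> soft_O C 2 ?f2 \<and> gate_count c \<le> soft_O C 2 ?f2" by blast+
qed

text \<open>\<open>\<Delta>\<close> determines \<open>\<Delta>0\<close> only up to the factors
  \<open>c1\<close> and \<open>c2\<close>. Dividing by \<open>c2\<close> gives a lower bound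
  \<open>D\<close> for \<open>\<Delta>0\<close> that loses at most the factor
  \<open>c1 / c2\<close>, on which alone \<open>C\<close> depends.\<close>

lemma gap_estimation_bounds:
  fixes c1 c2 \<beta> \<eta> \<epsilon> \<delta> \<Delta>true \<Delta> :: real
  defines "C \<equiv> 50000 + 442368 * (2 / (c1 / c2) + 1) * (8 + 2 / (c1 / c2))\<^sup>2"
  assumes c12: "0 < c1" "c1 \<le> c2" and \<beta>: "0 \<le> \<beta>" "\<beta> \<le> 1" and n: "1 \<le> n"
    and spec: "spectral_decomposition (2 ^ n) H E \<phi>"
    and E01: "0 \<le> E 0" "E 0 < E 1"
    and E_mono: "\<forall>i j. 1 \<le> i \<and> i \<le> j \<and> j < 2 ^ n \<longrightarrow> E i \<le> E j" and Epi: "E (2 ^ n - 1) \<le> pi"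
    and \<Delta>true: "\<Delta>true = E 1 - E 0"
    and \<psi>: "\<psi> = vec (2 ^ n) (\<lambda>a. \<Sum>j<2 ^ n. \<gamma> j * \<phi> j $ a)" and norm: "sq_norm \<psi> = 1"
    and \<eta>: "0 < \<eta>" "\<eta> < 1" "\<eta> \<le> (cmod (\<gamma> 0))\<^sup>2" and \<epsilon>: "0 < \<epsilon>" and \<delta>: "0 < \<delta>" "\<delta> < 1"
    and \<Delta>: "c1 * (\<epsilon> powr \<beta> * \<Delta>true powr (1 - \<beta>)) \<le> \<Delta>" "\<Delta> \<le> c2 * (\<epsilon> powr \<beta> * \<Delta>true powr (1 - \<beta>))"
  shows "measure_pmf.prob (run_algorithm n H \<psi> (gap_estimation \<eta> \<epsilon> \<delta> (\<Delta> / c2)))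
      {(cs, x). \<bar>x - E 0\<bar> \<le> \<epsilon>} \<ge> 1 - \<delta>"
    and "\<forall>(cs, x) \<in> set_pmf (run_algorithm n H \<psi> (gap_estimation \<eta> \<epsilon> \<delta> (\<Delta> / c2))).
      real (length cs) \<le> soft_O C 2
        (1 / \<eta> * (\<epsilon> powr (- 2 + 2 * \<beta>) * \<Delta>true powr (2 - 2 * \<beta>)
          + log1 (\<epsilon> powr (- \<beta>) * \<Delta>true powr (\<beta> - 1))) * log1 (1 / \<delta>)) \<and>
      (\<forall>c\<in>set cs.
        valid_circuit n c \<and>
        evolution_time c \<le> soft_O C 2
          (\<epsilon> powr (- \<beta>) * \<Delta>true powr (- 1 + \<beta>)
            * log1 (1 / \<eta> * \<Delta>true powr (1 - \<beta>) * \<epsilon> powr (\<beta> - 1))) \<and>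
        real (gate_count c) \<le> soft_O C 2
          (\<epsilon> powr (- \<beta>) * \<Delta>true powr (- 1 + \<beta>)
            * log1 (1 / \<eta> * \<Delta>true powr (1 - \<beta>) * \<epsilon> powr (\<beta> - 1))))"
      (is "\<forall>(cs, x) \<in> ?S. ?bounds cs")
proof -
  interpret eigenbasis n H E \<phi> by unfold_locales (rule spec)
  have mono: "E i \<le> E j" if "1 \<le> i" "i \<le> j" "j < N" for i j using E_mono that by blast
  have \<psi>': "\<psi> = eigen_comb \<gamma>" by (simp add: \<psi> eigen_comb_def)
  define c where "c = c1 / c2"
  have c: "0 < c" "c \<le> 1" "0 < c2" using c12 by (auto simp: c_def)
  define \<Delta>0 where "\<Delta>0 = \<epsilon> powr \<beta> * \<Delta>true powr (1 - \<beta>)"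
  define D where "D = \<Delta> / c2"
  have N2: "2 \<le> N" using power_increasing[of 1 n "2 :: nat"] n by simp
  then have N1: "1 \<le> N - 1" "N - 1 < N" by linarith+
  have E: "E 0 \<le> E j \<and> 0 \<le> E j \<and> E j \<le> pi" if "j < N" for j
  proof (cases "j = 0")
    case True
    then show ?thesis using E01 mono[OF _ N1] Epi by simp
  next
    case False
    then have "1 \<le> j" "j \<le> N - 1" using that by linarith+
    then show ?thesis using E01 mono[of 1 j] mono[OF _ _ N1(2), of j] Epi that by linarith
  qed
  have \<Delta>pos: "0 < \<Delta>true" and \<Delta>pi: "\<Delta>true \<le> pi" using \<Delta>true E01 E[of 1] N2 by auto
  have \<Delta>0: "0 < \<Delta>0" using \<epsilon> \<Delta>pos by (simp add: \<Delta>0_def)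
  have D: "c * \<Delta>0 \<le> D" "D \<le> \<Delta>0"
    using \<Delta> c(3) by (simp_all add: c_def D_def \<Delta>0_def field_simps)
  \<comment> \<open>\<open>\<Delta>0\<close> is a weighted geometric mean of
    \<open>\<epsilon>\<close> and \<open>\<Delta>true\<close>.\<close>
  have le_max: "\<Delta>0 \<le> max \<epsilon> \<Delta>true"
  proof -
    have "\<Delta>0 \<le> max \<epsilon> \<Delta>true powr \<beta> * max \<epsilon> \<Delta>true powr (1 - \<beta>)"
      unfolding \<Delta>0_def using \<beta> \<epsilon> \<Delta>pos by (intro mult_mono powr_mono2) auto
    also have "\<dots> = max \<epsilon> \<Delta>true" using \<epsilon> by (simp add: powr_add[symmetric])
    finally show ?thesis .
  qed
  have \<Delta>0_le: "\<Delta>0 \<le> max \<epsilon> pi" using le_max \<Delta>pi by auto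
  \<comment> \<open>Logarithms reduce the identities between powers to linear ones between
    exponents.\<close>
  define a where "a = ln \<epsilon>"
  define b where "b = ln \<Delta>true"
  have pw: "\<epsilon> powr z = exp (z * a)" "\<Delta>true powr z = exp (z * b)" for z
    using \<epsilon> \<Delta>pos by (simp_all add: powr_def a_def b_def)
  have \<Delta>0_exp: "\<Delta>0 = exp (\<beta> * a + (1 - \<beta>) * b)" by (simp add: \<Delta>0_def pw exp_add)
  have quot: "\<Delta>0 / \<epsilon> = exp (\<beta> * a + (1 - \<beta>) * b - a)"
    using \<epsilon> by (simp add: \<Delta>0_exp exp_diff a_def)
  have inv: "\<epsilon> powr (- \<beta>) * \<Delta>true powr (- 1 + \<beta>) = 1 / \<Delta>0"
  proof -
    have "\<epsilon> powr (- \<beta>) * \<Delta>true powr (- 1 + \<beta>) = exp (- (\<beta> * a + (1 - \<beta>) * b))"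
      by (simp add: pw mult_exp_exp algebra_simps)
    then show ?thesis by (simp only: \<Delta>0_exp exp_minus inverse_eq_divide)
  qed
  have ratio: "1 / \<eta> * \<Delta>true powr (1 - \<beta>) * \<epsilon> powr (\<beta> - 1) = \<Delta>0 / (\<epsilon> * \<eta>)"
  proof -
    have "\<Delta>true powr (1 - \<beta>) * \<epsilon> powr (\<beta> - 1) = \<Delta>0 / \<epsilon>"
      unfolding quot by (simp add: pw mult_exp_exp algebra_simps)
    then show ?thesis by (simp add: field_simps)
  qed
  have sq: "\<epsilon> powr (- 2 + 2 * \<beta>) * \<Delta>true powr (2 - 2 * \<beta>) = (\<Delta>0 / \<epsilon>)\<^sup>2"
    unfolding quot by (simp add: pw power2_eq_square mult_exp_exp algebra_simps)
  \<comment> \<open>From \<open>\<epsilon> < D \<le> \<Delta>0\<close> the maximum in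
    \<open>le_max\<close> has to be \<open>\<Delta>true\<close>. Thus the comparison
    \<open>\<epsilon> < D\<close>, which the algorithm can make, certifies \<open>D\<close> as a
    lower bound for the gap.\<close>
  have gap: "E 0 + D \<le> E j" if "\<epsilon> < D" "1 \<le> j" "j < N" for j
  proof -
    have "\<Delta>0 \<le> \<Delta>true" using le_max that(1) D(2) by (auto simp: max_def split: if_splits)
    then show ?thesis using mono[of 1 j] that \<Delta>true D(2) by simp
  qed
  have "D \<le> max \<epsilon> pi" using D(2) \<Delta>0_le by linarith
  then show "measure_pmf.prob (run_algorithm n H \<psi> (gap_estimation \<eta> \<epsilon> \<delta> (\<Delta> / c2)))
      {(cs, x). \<bar>x - E 0\<bar> \<le> \<epsilon>} \<ge> 1 - \<delta>"
    unfolding \<psi>' D_def[symmetric]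
    by (intro prob_gap_estimation[OF E norm[unfolded \<psi>'] \<eta> _ \<epsilon> \<delta> gap])
  have "?bounds cs" if "(cs, x) \<in> ?S" for cs x
  proof -
    have C: "50000 + 442368 * (2 / c + 1) * (8 + 2 / c)\<^sup>2 \<le> C" by (simp only: C_def c_def)
    note costs = gap_estimation_costs[OF c(1,2) \<Delta>0 \<Delta>0_le D \<epsilon> \<eta>(1,2) \<delta> C that[folded D_def]]
    show ?thesis
      \<comment> \<open>The goal contains the exponent both as \<open>- 1 + \<beta>\<close> and as
        \<open>\<beta> - 1\<close>.\<close>
      unfolding inv inv[unfolded add.commute[of "- 1" \<beta>, folded diff_conv_add_uminus]] ratio sq
      using costs by blast
  qed
  then show "\<forall>(cs, x) \<in> ?S. ?bounds cs" by blast
qed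

theorem corollary3p8:
  fixes c1 c2 :: real
  assumes "0 < c1" and "c1 \<le> c2"
  shows "\<exists>(C::real) (p::nat). C > 0 \<and>
    (\<forall>\<beta>::real. 0 \<le> \<beta> \<and> \<beta> \<le> 1 \<longrightarrow>
      (\<exists>alg :: nat \<Rightarrow> real \<Rightarrow> real \<Rightarrow> real \<Rightarrow> real \<Rightarrow> algorithm.
        \<forall>(n::nat) (H::complex mat) (E::nat \<Rightarrow> real) (\<phi>::nat \<Rightarrow> complex vec)
          (\<psi>::complex vec) (\<gamma>::nat \<Rightarrow> complex) (\<eta>::real) (\<epsilon>::real) (\<delta>::real)
          (\<Delta>true::real) (\<Delta>::real).
          n \<ge> 1 \<and>
          spectral_decomposition (2 ^ n) H E \<phi> \<and>
          0 \<le> E 0 \<and> E 0 < E 1 \<and>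
          (\<forall>i j. 1 \<le> i \<and> i \<le> j \<and> j < 2 ^ n \<longrightarrow> E i \<le> E j) \<and>
          E (2 ^ n - 1) \<le> pi \<and>
          \<Delta>true = E 1 - E 0 \<and>
          \<psi> = vec (2 ^ n) (\<lambda>a. \<Sum>j<2 ^ n. \<gamma> j * \<phi> j $ a) \<and>
          sq_norm \<psi> = 1 \<and>
          0 < \<eta> \<and> \<eta> < 1 \<and> (cmod (\<gamma> 0))\<^sup>2 \<ge> \<eta> \<and>
          \<epsilon> > 0 \<and> 0 < \<delta> \<and> \<delta> < 1 \<and>
          c1 * (\<epsilon> powr \<beta> * \<Delta>true powr (1 - \<beta>)) \<le> \<Delta> \<and>
          \<Delta> \<le> c2 * (\<epsilon> powr \<beta> * \<Delta>true powr (1 - \<beta>))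
          \<longrightarrow>
          measure_pmf.prob (run_algorithm n H \<psi> (alg n \<eta> \<epsilon> \<delta> \<Delta>))
            {(cs, x). \<bar>x - E 0\<bar> \<le> \<epsilon>} \<ge> 1 - \<delta> \<and>
          (\<forall>(cs, x) \<in> set_pmf (run_algorithm n H \<psi> (alg n \<eta> \<epsilon> \<delta> \<Delta>)).
            real (length cs) \<le> soft_O C p
              (1 / \<eta> * (\<epsilon> powr (- 2 + 2 * \<beta>) * \<Delta>true powr (2 - 2 * \<beta>)
                + log1 (\<epsilon> powr (- \<beta>) * \<Delta>true powr (\<beta> - 1))) * log1 (1 / \<delta>)) \<and>
            (\<forall>c\<in>set cs.
              valid_circuit n c \<and>
              evolution_time c \<le> soft_O C p
                (\<epsilon> powr (- \<beta>) * \<Delta>true powr (- 1 + \<beta>)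
                  * log1 (1 / \<eta> * \<Delta>true powr (1 - \<beta>) * \<epsilon> powr (\<beta> - 1))) \<and>
              real (gate_count c) \<le> soft_O C p
                (\<epsilon> powr (- \<beta>) * \<Delta>true powr (- 1 + \<beta>)
                  * log1 (1 / \<eta> * \<Delta>true powr (1 - \<beta>) * \<epsilon> powr (\<beta> - 1)))))))"
proof -
  define C where "C = 50000 + 442368 * (2 / (c1 / c2) + 1) * (8 + 2 / (c1 / c2))\<^sup>2"
  have C: "0 < C" unfolding C_def using assms by (intro add_pos_nonneg) auto
  \<comment> \<open>One algorithm serves every \<open>\<beta>\<close>, which enters only through the
    value of \<open>\<Delta>\<close>; this is why \<open>C\<close> and the exponent 2 can be fixed
    first.\<close>
  show ?thesis
    by (rule exI[of _ C], rule exI[of _ 2], rule conjI[OF C], intro allI impI,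
        rule exI[of _ "\<lambda>n \<eta> \<epsilon> \<delta> \<Delta>. gap_estimation \<eta> \<epsilon> \<delta> (\<Delta> / c2)"],
        intro allI impI, elim conjE, rule conjI)
      (rule gap_estimation_bounds[OF assms, folded C_def]; assumption)+
qed

end
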